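(* Let $K$ be a field, $\mathbf{A}=K\{\{x\}\}_\infty$ the $K$-algebra of planar tree power series in $x$ over $K$, $f\in\mathbf{A}$, and let $g\in\mathbf{A}$ be the unique power series with $\mathrm{ord}(g)\ge1$ and $g(x)=x\cdot f(g(x))$. Put $a(T)=c_T(f)$ and $b(T)=c_T(g)$ for $T\in\mathbf{PRT}'$. Then $$b(x)=a(1),$$ and for every right-sided tree $T\in\mathbf{PRT}$ with $\deg(T)>1$, $$b(T)=\sum_{Q\in\Gamma(T)}a(Q),\qquad\text{where}\quad a(Q):=\prod_{U\in Q,\ U=x\cdot U'}a(U'),$$ and $\Gamma(T)$ is the set of all right-sided decompositions of $T$.
   Context: Trees: $\mathbf{PRT}$ is the set of isomorphism classes of finite planar reduced rooted trees, i.e. finite rooted trees in which the outgoing edges (children) of each vertex are linearly ordered and no vertex has exactly one child. $\mathbf{PRT}'=\mathbf{PRT}\cup\{1\}$, where $1$ is the empty tree. The tree with a single vertex is denoted $x$. The degree $\deg(T)$ is the number of leaves (vertices without children) of $T$, and $\deg(1)=0$. The leaves of a planar tree are ordered from left to right; the first leaf is the leftmost one. Product of trees: for $S,T\in\mathbf{PRT}$, $S\cdot T$ is the tree whose root has exactly two children, the first branch being $S$ and the second being $T$; moreover $1\cdot T=T\cdot 1=T$ for all $T\in\mathbf{PRT}'$. A tree $T\in\mathbf{PRT}$ is right-sided if $T=x\cdot T'$ for some $T'\in\mathbf{PRT}'$; then $T'$ is uniquely determined by $T$ (and $T'=1$ for $T=x$). Planar tree power series: $\mathbf{A}=K\{\{x\}\}_\infty$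 is the $K$-vector space of formal sums $f=\sum_{T\in\mathbf{PRT}'}c_T(f)\,T$ with arbitrary coefficients $c_T(f)\in K$. Multiplication is $c_T(f\cdot h)=\sum_{(R,S):\,R\cdot S=T}c_R(f)c_S(h)$ (a finite sum over pairs in $\mathbf{PRT}'\times\mathbf{PRT}'$). The order $\mathrm{ord}(f)$ is the minimal degree of a $T$ with $c_T(f)\ne0$, with $\mathrm{ord}(0)=\infty$. Substitution: for $T\in\mathbf{PRT}$ of degree $n$ and $T_1,\dots,T_n\in\mathbf{PRT}$, let $*_T(T_1,\dots,T_n)$ be the tree obtained from $T$ by replacing the $i$-th leaf of $T$ by $T_i$ for all $i$. If $\mathrm{ord}(g)\ge1$, put $1(g)=1$, $T(g)=\sum_{T_1,\dots,T_n\in\mathbf{PRT}}c_{T_1}(g)\cdots c_{T_n}(g)\,*_T(T_1,\dots,T_n)$, and $f(g(x))=\sum_{T\in\mathbf{PRT}'}c_T(f)\,T(g)$. For every $f\in\mathbf{A}$ there is a unique $g\in\mathbf{A}$ with $\mathrm{ord}(g)\ge1$ and $g(x)=x\cdot f(g(x))$. Relatively open subtrees: a non-empty (connected) subtree $U$ of $T$ is rooted at its vertex closest to the root of $T$. It is relatively open in $T$ if every vertex $v$ of $U$ that has at least one child in $U$ has all of its $T$-children in $U$. Such a $U$ is, with the induced planar structure, itself a finite planar reduced rooted tree, so its leaves, its degree and the property of being right-sided make sense (for a one-vertex subtree $U=\{v\}$ one has $U=x=x\cdot 1$). Right-sided decompositions: let $T\in\mathbf{PRT}$ be right-sided with $\deg(T)>1$.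 A system $Q$ of relatively open subtrees of $T$ is called a right-sided decomposition of $T$ if: (i) each $U\in Q$ is right-sided; (ii) $\bigcup_{U\in Q}U=T$; (iii) if $b$ is a leaf of $T$, then $\{b\}\in Q$ if and only if $b$ is different from the first leaf of $T$; (iv) if $U,U'\in Q$, $U\cap U'\neq\emptyset$ and $U\ne U'$, then $U\cap U'=\{a\}$ for a vertex $a$ of $T$, and if $a$ is not the root of $U$, then $a$ is a leaf of $U$ and the root of $U'$. $\Gamma(T)$ denotes the set of all right-sided decompositions of $T$.
   Formalization: As printed the formula fails, e.g. for T=x·(x·x). Here (iii) reads: if b is a leaf of U in Q and U≠{b}, then b is the root of a member of Q iff b is not the first leaf of U. Added: distinct members of Q have distinct roots. In (ii) the union covers vertices and edges. *)

theory Defs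
  imports Main "HOL-Library.Extended_Nat" "HOL-Library.Groups_Big_Fun"
begin

section \<open>Planar reduced trees\<close>

text \<open>
  A vertex has either no child or at least two: \<open>Node S T Us\<close> is the tree whose root has the
  branches \<open>S, T\<close>, followed by those in \<open>Us\<close>, from left to right. The type \<open>prt\<close> is the set PRT;
  \<open>prt option\<close> is PRT', with \<open>None\<close> for the empty tree \<open>1\<close>. \<open>Leaf\<close> is the tree \<open>x\<close>.
\<close>

datatype prt = Leaf | Node prt prt "prt list"

fun children :: "prt \<Rightarrow> prt list" where
  "children Leaf = []"
| "children (Node S T Us) = S # T # Us"

fun deg :: "prt \<Rightarrow> nat" where
  "deg Leaf = 1"
| "deg (Node S T Us) = deg S + deg T + sum_list (map deg Us)"

fun deg' :: "prt option \<Rightarrow> nat" where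
  "deg' None = 0"
| "deg' (Some T) = deg T"

fun tree_mult :: "prt option \<Rightarrow> prt option \<Rightarrow> prt option" where
  "tree_mult None T = T"
| "tree_mult S None = S"
| "tree_mult (Some S) (Some T) = Some (Node S T [])"

definition right_sided :: "prt \<Rightarrow> bool" where
  "right_sided T \<longleftrightarrow> (\<exists>T'. Some T = tree_mult (Some Leaf) T')"

definition right_part :: "prt \<Rightarrow> prt option" where
  "right_part T = (THE T'. Some T = tree_mult (Some Leaf) T')"

lemma tree_mult_Leaf: "Some T = tree_mult (Some Leaf) T' \<longleftrightarrow>
    (case T' of None \<Rightarrow> T = Leaf | Some S \<Rightarrow> T = Node Leaf S [])"
  by (cases T') auto

lemma right_sided_simps [simp]:
  "right_sided Leaf" "right_sided (Node S T Us) \<longleftrightarrow> S = Leaf \<and> Us = []"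
  unfolding right_sided_def tree_mult_Leaf by (auto split: option.splits intro: exI[of _ None] exI[of _ "Some T"])

lemma right_part_simps [simp]:
  "right_part Leaf = None" "right_part (Node Leaf T []) = Some T"
  unfolding right_part_def tree_mult_Leaf by (rule the_equality; auto split: option.splits)+

text \<open>\<open>graft T Ts\<close> is \<open>*\<^sub>T(T\<^sub>1, \<dots>, T\<^sub>n)\<close>; it is only used if \<open>length Ts = deg T\<close>.\<close>

fun graft :: "prt \<Rightarrow> prt list \<Rightarrow> prt" and graft_list :: "prt list \<Rightarrow> prt list \<Rightarrow> prt list" where
  "graft Leaf Ts = hd Ts"
| "graft (Node S T Us) Ts =
     Node (graft S (take (deg S) Ts))
          (graft T (take (deg T) (drop (deg S) Ts)))
          (graft_list Us (drop (deg S + deg T) Ts))"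
| "graft_list [] Ts = []"
| "graft_list (U # Us) Ts = graft U (take (deg U) Ts) # graft_list Us (drop (deg U) Ts)"


section \<open>Planar tree power series\<close>

text \<open>A series \<open>f\<close> is its coefficient function, \<open>f T = c\<^sub>T(f)\<close>.\<close>

type_synonym 'k tree_series = "prt option \<Rightarrow> 'k"

definition series_x :: "'k::field tree_series" where
  "series_x T = (if T = Some Leaf then 1 else 0)"

definition series_mult :: "'k::field tree_series \<Rightarrow> 'k tree_series \<Rightarrow> 'k tree_series" where
  "series_mult f h T = (\<Sum>(R, S) \<in> {(R, S). tree_mult R S = T}. f R * h S)"

definition series_ord :: "'k::field tree_series \<Rightarrow> enat" where
  "series_ord f = (INF T \<in> {T. f T \<noteq> 0}. enat (deg' T))"

fun tree_subst :: "prt option \<Rightarrow> 'k::field tree_series \<Rightarrow> 'k tree_series" where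
  "tree_subst None g = (\<lambda>S. if S = None then 1 else 0)"
| "tree_subst (Some T) g = (\<lambda>S.
     \<Sum>Ts \<in> {Ts. length Ts = deg T \<and> Some (graft T Ts) = S}. \<Prod>T'\<leftarrow>Ts. g (Some T'))"

text \<open>
  \<open>f(g(x))\<close>. The coefficient at \<open>S\<close> is a sum over all \<open>T\<close>, of which only those of degree at most
  \<open>deg' S\<close> contribute, so that \<open>Sum_any\<close> is the intended finite sum.
\<close>

definition series_subst :: "'k::field tree_series \<Rightarrow> 'k tree_series \<Rightarrow> 'k tree_series" where
  "series_subst f g S = Sum_any (\<lambda>T. f T * tree_subst T g S)"


text \<open>The sums in the last three definitions are finite.\<close>

lemma finite_tree_mult: "finite {(R, S). tree_mult R S = T}"
proof -
  have "p \<in> {(None, T), (T, None)} \<union>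
      (\<lambda>U. case U of Some (Node S S' Us) \<Rightarrow> (Some S, Some S')) ` {T}"
    if "p \<in> {(R, S). tree_mult R S = T}" for p
  proof -
    obtain R S where "p = (R, S)" by fastforce
    then show ?thesis using that by (cases R; cases S) auto
  qed
  then have "{(R, S). tree_mult R S = T} \<subseteq> {(None, T), (T, None)} \<union>
      (\<lambda>U. case U of Some (Node S S' Us) \<Rightarrow> (Some S, Some S')) ` {T}"
    by blast
  then show ?thesis by (rule finite_subset) simp
qed

lemma deg_pos: "deg T \<ge> 1"
  by (induction T) auto

lemma length_le_sum_list_deg: "length Us \<le> sum_list (map deg Us)"
proof (induction Us)
  case (Cons U Us)
  then show ?case using deg_pos[of U] by simp
qed simp

lemma finite_deg_le: "finite {T. deg T \<le> n}"
proof (induction n)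
  case 0
  then show ?case using deg_pos by (metis (mono_tags, lifting) Collect_empty_eq finite.emptyI not_one_le_zero order_trans)
next
  case (Suc n)
  let ?A = "{T. deg T \<le> n}"
  have "{T. deg T \<le> Suc n} \<subseteq> insert Leaf ((\<lambda>(S, T, Us). Node S T Us) `
      (?A \<times> ?A \<times> {Us. set Us \<subseteq> ?A \<and> length Us \<le> n}))"
  proof
    fix T assume "T \<in> {T. deg T \<le> Suc n}"
    then have le: "deg T \<le> Suc n" by simp
    show "T \<in> insert Leaf ((\<lambda>(S, T, Us). Node S T Us) `
      (?A \<times> ?A \<times> {Us. set Us \<subseteq> ?A \<and> length Us \<le> n}))"
    proof (cases T)
      case (Node A B Us)
      have U: "deg U \<le> sum_list (map deg Us)" if "U \<in> set Us" for U
        using that by (simp add: member_le_sum_list)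
      have "deg A \<le> n" "deg B \<le> n" "length Us \<le> n" "\<forall>U\<in>set Us. deg U \<le> n"
        using le Node deg_pos[of A] deg_pos[of B] length_le_sum_list_deg[of Us] U by fastforce+
      then show ?thesis using Node by (auto intro!: image_eqI[of _ _ "(A, B, Us)"])
    qed simp
  qed
  moreover have "finite {Us. set Us \<subseteq> ?A \<and> length Us \<le> n}"
    using Suc by (rule finite_lists_length_le)
  ultimately show ?case using Suc by (auto intro: finite_subset)
qed

lemma deg_graft:
  "length Ts = deg T \<Longrightarrow> deg (graft T Ts) = sum_list (map deg Ts)"
  "length Ts = sum_list (map deg Us) \<Longrightarrow> sum_list (map deg (graft_list Us Ts)) = sum_list (map deg Ts)"
proof (induction T Ts and Us Ts rule: graft_graft_list.induct)
  case (1 Ts)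
  then show ?case by (cases Ts) auto
next
  case (2 S T Us Ts)
  let ?s = "\<lambda>Ts. sum_list (map deg Ts)"
  have "?s Ts = ?s (take (deg S) Ts) + ?s (drop (deg S) Ts)"
    by (metis append_take_drop_id map_append sum_list_append)
  also have "?s (drop (deg S) Ts) = ?s (take (deg T) (drop (deg S) Ts)) + ?s (drop (deg T) (drop (deg S) Ts))"
    by (metis append_take_drop_id map_append sum_list_append)
  finally show ?case using 2 by (simp add: add.commute)
next
  case (4 U Us Ts)
  have "sum_list (map deg Ts) = sum_list (map deg (take (deg U) Ts)) + sum_list (map deg (drop (deg U) Ts))"
    by (metis append_take_drop_id map_append sum_list_append)
  then show ?case using 4 by simp
qed simp

lemma deg_le_deg_graft: "length Ts = deg T \<Longrightarrow> deg T \<le> deg (graft T Ts)"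
  by (metis deg_graft(1) length_le_sum_list_deg)

lemma finite_graft: "finite {Ts. length Ts = deg T \<and> Some (graft T Ts) = S}"
proof (rule finite_subset)
  show "{Ts. length Ts = deg T \<and> Some (graft T Ts) = S} \<subseteq>
      {Ts. set Ts \<subseteq> {U. deg U \<le> deg' S} \<and> length Ts = deg T}"
    using deg_graft(1) by (fastforce intro: member_le_sum_list)
  show "finite \<dots>" by (intro finite_lists_length_eq finite_deg_le)
qed

lemma finite_series_subst: "finite {T. f T * tree_subst T g S \<noteq> 0}"
proof (rule finite_subset)
  show "{T. f T * tree_subst T g S \<noteq> 0} \<subseteq> insert None (Some ` {T. deg T \<le> deg' S})"
  proof
    fix T assume "T \<in> {T. f T * tree_subst T g S \<noteq> 0}"
    then have nz: "tree_subst T g S \<noteq> 0" by auto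
    show "T \<in> insert None (Some ` {T. deg T \<le> deg' S})"
    proof (cases T)
      case (Some U)
      have "{Ts. length Ts = deg U \<and> Some (graft U Ts) = S} \<noteq> {}"
      proof
        assume "{Ts. length Ts = deg U \<and> Some (graft U Ts) = S} = {}"
        then show False using nz Some by (simp only: tree_subst.simps sum.empty simp_thms)
      qed
      then show ?thesis using Some deg_le_deg_graft by auto
    qed simp
  qed
qed (simp add: finite_deg_le)


section \<open>Relatively open subtrees\<close>

text \<open>
  A vertex is addressed by the path from the root to it: \<open>v @ [i]\<close> is the child number \<open>i\<close>
  (from the left, starting with 0) of \<open>v\<close>. A subtree is given by its vertex set; its edges are all
  edges of the ambient tree between its vertices.
\<close>

type_synonym vertex = "nat list"

fun has_vertex :: "prt \<Rightarrow> vertex \<Rightarrow> bool" where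
  "has_vertex T [] \<longleftrightarrow> True"
| "has_vertex T (i # v) \<longleftrightarrow> i < length (children T) \<and> has_vertex (children T ! i) v"

definition vertices :: "prt \<Rightarrow> vertex set" where
  "vertices T = {v. has_vertex T v}"

definition edges_on :: "vertex set \<Rightarrow> (vertex \<times> vertex) set" where
  "edges_on U = {(v, w). v \<in> U \<and> w \<in> U \<and> (\<exists>i. w = v @ [i])}"

definition connected_on :: "vertex set \<Rightarrow> bool" where
  "connected_on U \<longleftrightarrow> (\<forall>v\<in>U. \<forall>w\<in>U. (v, w) \<in> (edges_on U \<union> (edges_on U)\<inverse>)\<^sup>*)"

definition rel_open_subtree :: "prt \<Rightarrow> vertex set \<Rightarrow> bool" where
  "rel_open_subtree T U \<longleftrightarrow>
     U \<subseteq> vertices T \<and> U \<noteq> {} \<and> connected_on U \<and>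
     (\<forall>v\<in>U. (\<exists>i. v @ [i] \<in> U) \<longrightarrow> (\<forall>i. v @ [i] \<in> vertices T \<longrightarrow> v @ [i] \<in> U))"

definition root_vertex :: "vertex set \<Rightarrow> vertex" where
  "root_vertex U = (ARG_MIN length v. v \<in> U)"

definition leaf_vertices :: "vertex set \<Rightarrow> vertex set" where
  "leaf_vertices U = {v \<in> U. \<forall>i. v @ [i] \<notin> U}"

text \<open>
  The planar reduced tree formed by a relatively open subtree. Since the children in \<open>T\<close> of an inner
  vertex of \<open>U\<close> all lie in \<open>U\<close>, they keep their numbers, and the isomorphism with the induced tree
  just removes the prefix \<open>root_vertex U\<close> from every address. Existence and uniqueness of this tree
  is the lemma \<open>induced_tree\<close> below.
\<close>

definition induced_tree :: "vertex set \<Rightarrow> prt" where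
  "induced_tree U = (THE S. U = (\<lambda>v. root_vertex U @ v) ` vertices S)"

lemma length_children_eq: "vertices S = vertices T \<Longrightarrow> length (children S) = length (children T)"
proof -
  assume "vertices S = vertices T"
  then have "i < length (children S) \<longleftrightarrow> i < length (children T)" for i
    by (auto simp: vertices_def set_eq_iff dest: spec[of _ "[i]"])
  then show ?thesis by (meson linorder_neq_iff)
qed

lemma vertices_inject: "vertices S = vertices T \<Longrightarrow> S = T"
proof (induction S arbitrary: T)
  case Leaf
  show ?case using length_children_eq[OF Leaf] by (cases T) auto
next
  case (Node A B Us)
  note l = length_children_eq[OF Node.prems]
  then obtain A' B' Us' where T: "T = Node A' B' Us'" by (cases T) auto
  have sub: "vertices (children (Node A B Us) ! i) = vertices (children T ! i)"
    if "i < length (children T)" for i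
    unfolding vertices_def
  proof (rule Collect_cong)
    fix v
    have "has_vertex (Node A B Us) (i # v) \<longleftrightarrow> has_vertex T (i # v)"
      using Node.prems unfolding vertices_def by blast
    then show "has_vertex (children (Node A B Us) ! i) v \<longleftrightarrow> has_vertex (children T ! i) v"
      using that l by auto
  qed
  have "A = A'" using sub[of 0] T Node.IH(1) by simp
  moreover have "B = B'" using sub[of 1] T Node.IH(2) by simp
  moreover have "Us = Us'"
  proof (rule nth_equalityI)
    show "length Us = length Us'" using l T by simp
    show "Us ! i = Us' ! i" if "i < length Us" for i
      using sub[of "Suc (Suc i)"] T Node.IH(3)[of "Us ! i"] that l by simp
  qed
  ultimately show ?case using T by simp
qed

lemma ex_vertices:
  assumes "D \<subseteq> vertices T" "[] \<in> D" "\<And>v w. v @ w \<in> D \<Longrightarrow> v \<in> D"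
    "\<And>v i j. v @ [i] \<in> D \<Longrightarrow> v @ [j] \<in> vertices T \<Longrightarrow> v @ [j] \<in> D"
  shows "\<exists>S. D = vertices S"
  using assms
proof (induction T arbitrary: D)
  case Leaf
  have "v = []" if "has_vertex Leaf v" for v using that by (cases v) auto
  then have "D = vertices Leaf" using Leaf by (auto simp: vertices_def)
  then show ?case by blast
next
  case (Node A B Us)
  let ?T = "Node A B Us" let ?n = "length Us + 2"
  show ?case
  proof (cases "\<exists>i. [i] \<in> D")
    case False
    have L: "has_vertex Leaf v \<longleftrightarrow> v = []" for v by (cases v) auto
    have "v = []" if "v \<in> D" for v
      using that Node.prems(3)[of "[hd v]" "tl v"] False by (cases v) auto
    then have "D = vertices Leaf" using Node.prems(2) by (auto simp: vertices_def L)
    then show ?thesis by blast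
  next
    case True
    have all: "[i] \<in> D \<longleftrightarrow> i < ?n" for i
      using True Node.prems(1) Node.prems(4)[of "[]" _ i] by (auto simp: vertices_def)
    have "\<exists>S. {v. i # v \<in> D} = vertices S" if "i < ?n" for i
    proof -
      have IH: "\<exists>S. E = vertices S" if "E \<subseteq> vertices (children ?T ! i)" "[] \<in> E"
        "\<And>v w. v @ w \<in> E \<Longrightarrow> v \<in> E"
        "\<And>v k j. v @ [k] \<in> E \<Longrightarrow> v @ [j] \<in> vertices (children ?T ! i) \<Longrightarrow> v @ [j] \<in> E" for E
      proof -
        consider "i = 0" | "i = 1" | k where "i = Suc (Suc k)" "k < length Us"
          using \<open>i < ?n\<close> by (cases i; cases "i - 1"; auto)
        then show ?thesis
        proof cases
          case 1
          then show ?thesis using Node.IH(1)[of E] that by simp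
        next
          case 2
          then show ?thesis using Node.IH(2)[of E] that by simp
        next
          case 3
          then show ?thesis using Node.IH(3)[of "Us ! k" E] that by simp
        qed
      qed
      show ?thesis
      proof (rule IH)
        show "{v. i # v \<in> D} \<subseteq> vertices (children ?T ! i)"
          using Node.prems(1) by (auto simp: vertices_def simp del: children.simps)
        show "[] \<in> {v. i # v \<in> D}" using all that by simp
        show "v \<in> {v. i # v \<in> D}" if "v @ w \<in> {v. i # v \<in> D}" for v w
          using Node.prems(3)[of "i # v" w] that by simp
        show "v @ [j] \<in> {v. i # v \<in> D}"
          if "v @ [k] \<in> {v. i # v \<in> D}" "v @ [j] \<in> vertices (children ?T ! i)" for v k j
          using Node.prems(4)[of "i # v" k j] that \<open>i < ?n\<close> by (simp add: vertices_def)
      qed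
    qed
    then obtain F where F: "\<And>i. i < ?n \<Longrightarrow> {v. i # v \<in> D} = vertices (F i)" by metis
    let ?S = "Node (F 0) (F 1) (map (\<lambda>k. F (Suc (Suc k))) [0..<length Us])"
    have nth: "children ?S ! i = F i" if "i < ?n" for i
      using that by (cases i; cases "i - 1"; auto)
    have "v \<in> D \<longleftrightarrow> has_vertex ?S v" for v
    proof (cases v)
      case (Cons i w)
      show ?thesis
      proof (cases "i < ?n")
        case True
        have "has_vertex ?S (i # w) \<longleftrightarrow> has_vertex (F i) w" using nth[OF True] True by simp
        then show ?thesis using F[OF True] Cons by (auto simp: vertices_def)
      next
        case False
        then show ?thesis using Cons Node.prems(3)[of "[i]" w] all by auto
      qed
    qed (simp add: Node.prems(2))
    then have "D = vertices ?S" by (auto simp: vertices_def)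
    then show ?thesis by blast
  qed
qed

lemma ex_subtree_at: "has_vertex T r \<Longrightarrow> \<exists>S. \<forall>v. has_vertex T (r @ v) \<longleftrightarrow> has_vertex S v"
proof (induction r arbitrary: T)
  case Nil
  show ?case by (rule exI[of _ T]) simp
next
  case (Cons i r)
  from Cons.prems have i: "i < length (children T)" and "has_vertex (children T ! i) r" by simp_all
  then obtain S where "\<forall>v. has_vertex (children T ! i) (r @ v) \<longleftrightarrow> has_vertex S v"
    using Cons.IH by blast
  with i have "\<forall>v. has_vertex T ((i # r) @ v) \<longleftrightarrow> has_vertex S v" by simp
  then show ?case by (rule exI)
qed

lemma root_vertex:
  assumes "rel_open_subtree T U"
  shows "root_vertex U \<in> U" and "v \<in> U \<Longrightarrow> length (root_vertex U) \<le> length v"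
proof -
  from assms obtain w where "w \<in> U" by (auto simp: rel_open_subtree_def)
  then show "root_vertex U \<in> U"
    unfolding root_vertex_def by (rule arg_min_natI)
  show "v \<in> U \<Longrightarrow> length (root_vertex U) \<le> length v"
    unfolding root_vertex_def by (rule arg_min_nat_le)
qed

lemma subtree_prefix:
  assumes "rel_open_subtree T U" "v \<in> U"
  shows "\<exists>q. v = root_vertex U @ q \<and> (\<forall>k. root_vertex U @ take k q \<in> U)"
proof -
  let ?r = "root_vertex U"
  have "(?r, v) \<in> (edges_on U \<union> (edges_on U)\<inverse>)\<^sup>*"
    using assms root_vertex(1)[OF assms(1)] by (auto simp: rel_open_subtree_def connected_on_def)
  then show ?thesis
  proof (induction rule: rtrancl_induct)
    case base
    show ?case using root_vertex(1)[OF assms(1)] by auto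
  next
    case (step v w)
    then obtain q where q: "v = ?r @ q" "\<forall>k. ?r @ take k q \<in> U" by blast
    from step(2) consider i where "w = v @ [i]" "w \<in> U" | i where "v = w @ [i]" "w \<in> U"
      by (auto simp: edges_on_def)
    then show ?case
    proof cases
      case 1
      have "?r @ take k (q @ [i]) \<in> U" for k
        using q 1 by (cases "k \<le> length q") auto
      then show ?thesis using 1 q(1) by (intro exI[of _ "q @ [i]"]) auto
    next
      case 2
      have "length ?r \<le> length w" using root_vertex(2)[OF assms(1) 2(2)] .
      then have "q \<noteq> []" using 2 q(1) by (metis append_Nil2 length_append_singleton not_less_eq_eq order_refl)
      then have "w = ?r @ butlast q" using 2 q(1)
        by (metis butlast_append butlast_snoc)
      moreover have "?r @ take k (butlast q) \<in> U" for k
        using q(2)[rule_format, of "min k (length q - 1)"] by (simp add: butlast_conv_take)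
      ultimately show ?thesis by blast
    qed
  qed
qed

lemma induced_tree:
  assumes "rel_open_subtree T U"
  shows "\<exists>!S. U = (\<lambda>v. root_vertex U @ v) ` vertices S"
proof -
  let ?r = "root_vertex U" let ?D = "{v. ?r @ v \<in> U}"
  have rT: "has_vertex T ?r"
    using root_vertex(1)[OF assms] assms by (auto simp: rel_open_subtree_def vertices_def)
  obtain S0 where S0: "\<And>v. has_vertex T (?r @ v) \<longleftrightarrow> has_vertex S0 v"
    using ex_subtree_at[OF rT] by blast
  have "\<exists>S. ?D = vertices S"
  proof (rule ex_vertices)
    show "?D \<subseteq> vertices S0"
      using assms S0 by (auto simp: rel_open_subtree_def vertices_def)
    show "[] \<in> ?D" using root_vertex(1)[OF assms] by simp
    show "v \<in> ?D" if vw: "v @ w \<in> ?D" for v w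
    proof -
      from vw have "?r @ v @ w \<in> U" by simp
      then obtain q where q: "?r @ v @ w = ?r @ q" "\<forall>k. ?r @ take k q \<in> U"
        using subtree_prefix[OF assms, of "?r @ v @ w"] by metis
      have "q = v @ w" using q(1) by simp
      then show ?thesis using q(2)[rule_format, of "length v"] by simp
    qed
    show "v @ [j] \<in> ?D" if i: "v @ [i] \<in> ?D" and j: "v @ [j] \<in> vertices S0" for v i j
    proof -
      from i have "?r @ v @ [i] \<in> U" by simp
      then obtain q where q: "?r @ v @ [i] = ?r @ q" "\<forall>k. ?r @ take k q \<in> U"
        using subtree_prefix[OF assms, of "?r @ v @ [i]"] by metis
      have "q = v @ [i]" using q(1) by simp
      then have "?r @ v \<in> U" using q(2)[rule_format, of "length v"] by simp
      moreover have "(?r @ v) @ [j] \<in> vertices T" using j S0 by (simp add: vertices_def)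
      moreover have "(?r @ v) @ [i] \<in> U" using i by simp
      ultimately have "(?r @ v) @ [j] \<in> U" using assms unfolding rel_open_subtree_def by blast
      then show ?thesis by simp
    qed
  qed
  then obtain S where S: "?D = vertices S" by blast
  show ?thesis
  proof (rule ex1I)
    show "U = (\<lambda>v. ?r @ v) ` vertices S"
      using subtree_prefix[OF assms] unfolding S[symmetric] by blast
    fix S' assume "U = (\<lambda>v. ?r @ v) ` vertices S'"
    then have "vertices S' = ?D" by blast
    then show "S' = S" using S vertices_inject by simp
  qed
qed

fun leftmost_leaf :: "prt \<Rightarrow> vertex" where
  "leftmost_leaf Leaf = []"
| "leftmost_leaf (Node S T Us) = 0 # leftmost_leaf S"

definition first_leaf :: "vertex set \<Rightarrow> vertex" where
  "first_leaf U = root_vertex U @ leftmost_leaf (induced_tree U)"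


section \<open>Right-sided decompositions\<close>

text \<open>
  The conditions are, in this order:
  (i) the members are right-sided relatively open subtrees;
  (ii) they cover \<open>T\<close>, vertices and edges;
  (iii) if \<open>b\<close> is a leaf of \<open>U \<in> Q\<close>, \<open>U \<noteq> {b}\<close>, then \<open>b\<close> is the root of a member of \<open>Q\<close> if and only if
  \<open>b\<close> is different from the first leaf of \<open>U\<close>;
  (iv) distinct members that meet do so in a single vertex \<open>a\<close>, and if \<open>a\<close> is not the root of \<open>U\<close>, then
  \<open>a\<close> is a leaf of \<open>U\<close> and the root of \<open>U'\<close>;
  (v) distinct members have distinct roots.

  If \<open>b\<close> is a leaf of \<open>T\<close>, then \<open>{b}\<close> is the only subtree with root \<open>b\<close>. So (iii) decides which
  one-vertex trees \<open>{b}\<close> are members, and for the member containing the root of \<open>T\<close> it says that the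
  first leaf of \<open>T\<close> is not one of them. Together with (ii) and (iv), (iii) also implies that the
  first leaf of every \<open>U \<in> Q\<close> is a leaf of \<open>T\<close>.

  Beware: in print, (iii) reads "if \<open>b\<close> is a leaf of \<open>T\<close>, then \<open>{b} \<in> Q\<close> if and only if \<open>b\<close> is different
  from the first leaf of \<open>T\<close>", and (v) is missing. With that definition the inversion formula fails.
  Every term of \<open>b(T)\<close> would have at least \<open>deg T - 1\<close> factors \<open>a(1)\<close>, but for
  \<open>T = x\<cdot>(x\<cdot>x)\<close> one has \<open>b(T) = a(x)\<^sup>2 a(1) + a(x\<cdot>x) a(1)\<^sup>2\<close>: the leaf \<open>b\<close> that is the first
  leaf of the lower copy of \<open>x\<cdot>x\<close> must not contribute a factor \<open>a(1)\<close>, i.e. "first leaf" has to be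
  understood relative to the members \<open>U\<close>. Without (v), the one-vertex subtree at an inner vertex could
  be added to \<open>Q\<close>: for \<open>T = x\<cdot>x\<close> with root \<open>r\<close> and second leaf \<open>b\<close>, both \<open>{T, {b}}\<close> and
  \<open>{T, {b}, {r}}\<close> would be decompositions, but \<open>b(T) = a(x) a(1)\<close>.
\<close>

definition right_sided_decomposition :: "prt \<Rightarrow> vertex set set \<Rightarrow> bool" where
  "right_sided_decomposition T Q \<longleftrightarrow>
     (\<forall>U\<in>Q. rel_open_subtree T U \<and> right_sided (induced_tree U)) \<and>
     (\<Union>U\<in>Q. U) = vertices T \<and> (\<Union>U\<in>Q. edges_on U) = edges_on (vertices T) \<and>
     (\<forall>U\<in>Q. \<forall>b\<in>leaf_vertices U. U \<noteq> {b} \<longrightarrow>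
        ((\<exists>U'\<in>Q. root_vertex U' = b) \<longleftrightarrow> b \<noteq> first_leaf U)) \<and>
     (\<forall>U\<in>Q. \<forall>U'\<in>Q. U \<inter> U' \<noteq> {} \<and> U \<noteq> U' \<longrightarrow>
        (\<exists>a. U \<inter> U' = {a} \<and>
          (a \<noteq> root_vertex U \<longrightarrow> a \<in> leaf_vertices U \<and> a = root_vertex U'))) \<and>
     (\<forall>U\<in>Q. \<forall>U'\<in>Q. U \<noteq> U' \<longrightarrow> root_vertex U \<noteq> root_vertex U')"

definition right_sided_decompositions :: "prt \<Rightarrow> vertex set set set" where
  "right_sided_decompositions T = {Q. right_sided_decomposition T Q}"

definition decomposition_coeff :: "'k::field tree_series \<Rightarrow> vertex set set \<Rightarrow> 'k" where
  "decomposition_coeff f Q = (\<Prod>U\<in>Q. f (right_part (induced_tree U)))"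

lemma finite_vertices: "finite (vertices T)"
proof (induction T)
  case Leaf
  have "has_vertex Leaf v \<longleftrightarrow> v = []" for v by (cases v) auto
  then show ?case by (simp add: vertices_def)
next
  case (Node A B Us)
  let ?C = "children (Node A B Us)"
  have "vertices (Node A B Us) \<subseteq> insert [] (\<Union>i<length ?C. (#) i ` vertices (?C ! i))"
  proof
    fix v assume "v \<in> vertices (Node A B Us)"
    then show "v \<in> insert [] (\<Union>i<length ?C. (#) i ` vertices (?C ! i))"
      by (cases v) (auto simp: vertices_def simp del: children.simps)
  qed
  moreover have "finite (vertices (?C ! i))" if "i < length ?C" for i
  proof -
    have "?C ! i \<in> set ?C" using that by (rule nth_mem)
    then show ?thesis using Node.IH by auto
  qed
  ultimately show ?case by (auto intro: finite_subset simp del: children.simps)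
qed

lemma finite_right_sided_decompositions:
  "finite (right_sided_decompositions T)" "Q \<in> right_sided_decompositions T \<Longrightarrow> finite Q"
proof -
  have *: "Q \<subseteq> Pow (vertices T)" if "Q \<in> right_sided_decompositions T" for Q
    using that by (auto simp: right_sided_decompositions_def right_sided_decomposition_def)
  then have "right_sided_decompositions T \<subseteq> Pow (Pow (vertices T))" by blast
  then show "finite (right_sided_decompositions T)"
    by (rule finite_subset) (simp add: finite_vertices)
  show "finite Q" if "Q \<in> right_sided_decompositions T"
    using *[OF that] by (rule finite_subset) (simp add: finite_vertices)
qed

end

theory Submission
  imports Defs "HOL-Library.FuncSet"
begin

text \<open>
  The coefficients of \<open>g\<close> and the weighted numbers of decompositions satisfy the same recursion.

  Comparing coefficients in \<open>g = x\<cdot>f(g)\<close> shows that \<open>b(T) = 0\<close> unless \<open>T\<close> is right-sided, that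
  \<open>b(x) = a(1)\<close>, and that \<open>b(x\<cdot>T)\<close> is the coefficient of \<open>f(g)\<close> at \<open>T\<close>. If \<open>T\<close> arises by grafting
  trees onto \<open>S\<close>, then \<open>S\<close> is a relatively open subtree of \<open>T\<close> at the root of \<open>T\<close>, and the grafted
  trees are the branches \<open>T\<^sub>b\<close> of \<open>T\<close> at the leaves \<open>b\<close> of \<open>S\<close>; conversely, every such \<open>S\<close> occurs
  exactly once. Therefore (\<open>series_subst_Some\<close>)
  \<open>b(x\<cdot>T) = \<Sum>\<^sub>S a(S) \<Prod>\<^sub>b b(T\<^sub>b)\<close>, summed over these \<open>S\<close>.

  On the other side, the member of a decomposition of \<open>x\<cdot>T\<close> that is rooted at the root of \<open>x\<cdot>T\<close> is
  \<open>x\<cdot>S\<close> for one of these \<open>S\<close>. Its first leaf is not the root of a member, each of the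
  leaves \<open>b\<close> of \<open>S\<close> is one, and the members other than \<open>x\<cdot>S\<close> fall apart into one decomposition of
  \<open>T\<^sub>b\<close> for every \<open>b\<close>, which may be chosen independently (\<open>tilings_right_sided\<close>). As \<open>a(Q)\<close> is
  multiplicative, the sums of \<open>a(Q)\<close> obey the recursion of \<open>b\<close>.

  For the induction to close, the formula is needed at all trees, since a branch \<open>T\<^sub>b\<close> is
  arbitrary. It does hold there: the only decomposition of \<open>x\<close> consists of \<open>x\<close> itself and has weight
  \<open>a(1)\<close>, and a tree with a decomposition is right-sided (\<open>tiling_right_sided\<close>).

  The combinatorics is carried out with the map that takes the root of each member of a decomposition
  to the shape of that member (\<open>tiling\<close>), because restriction to a branch and gluing are easy to
  describe for such maps; \<open>bij_members\<close> translates between the two descriptions.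
\<close>

section \<open>Branches, leaves and initial subtrees\<close>

lemma vertices_Nil [simp]: "[] \<in> vertices T"
  by (simp add: vertices_def)

lemma vertices_Leaf [simp]: "vertices Leaf = {[]}"
proof -
  have "has_vertex Leaf v \<longleftrightarrow> v = []" for v by (cases v) auto
  then show ?thesis by (simp add: vertices_def)
qed

lemma vertices_Cons:
  "i # v \<in> vertices T \<longleftrightarrow> i < length (children T) \<and> v \<in> vertices (children T ! i)"
  by (simp add: vertices_def)

lemma vertices_right_sided [simp]:
  "i # v \<in> vertices (Node Leaf S []) \<longleftrightarrow> i = 0 \<and> v = [] \<or> i = 1 \<and> v \<in> vertices S"
  by (cases "i - 1"; cases i) (auto simp: vertices_Cons)

fun branch :: "prt \<Rightarrow> vertex \<Rightarrow> prt" where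
  "branch T [] = T"
| "branch T (i # v) = branch (children T ! i) v"

lemma branch_append: "branch T (v @ w) = branch (branch T v) w"
  by (induction T v rule: branch.induct) auto

lemma vertices_append:
  "v @ w \<in> vertices T \<longleftrightarrow> v \<in> vertices T \<and> w \<in> vertices (branch T v)"
  by (induction T v rule: branch.induct) (auto simp: vertices_Cons)

lemma deg_child_le: "i < length (children T) \<Longrightarrow> deg (children T ! i) \<le> deg T"
proof (cases T)
  case (Node A B Us)
  assume "i < length (children T)"
  then have "children T ! i \<in> set (children T)" by (rule nth_mem)
  then show ?thesis using Node member_le_sum_list[of _ "map deg Us"] by fastforce
qed simp

lemma deg_branch_le: "v \<in> vertices T \<Longrightarrow> deg (branch T v) \<le> deg T"
  by (induction T v rule: branch.induct)
    (auto simp: vertices_Cons intro: order_trans[OF _ deg_child_le])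

abbreviation tree_leaves :: "prt \<Rightarrow> vertex set" where
  "tree_leaves S \<equiv> leaf_vertices (vertices S)"

lemma tree_leaves_subset: "tree_leaves S \<subseteq> vertices S"
  by (auto simp: leaf_vertices_def)

lemma finite_tree_leaves: "finite (tree_leaves S)"
  using tree_leaves_subset finite_vertices by (rule finite_subset)

lemma leaf_vertices_singleton [simp]: "leaf_vertices {v} = {v}"
  by (auto simp: leaf_vertices_def)

lemma tree_leaves_iff: "v \<in> tree_leaves S \<longleftrightarrow> v \<in> vertices S \<and> branch S v = Leaf"
proof -
  have "(\<exists>i. [i] \<in> vertices T) \<longleftrightarrow> T \<noteq> Leaf" for T
    by (cases T) (auto simp: vertices_Cons)
  then show ?thesis by (auto simp: leaf_vertices_def vertices_append)
qed

lemma tree_leaves_Nil [simp]: "[] \<in> tree_leaves S \<longleftrightarrow> S = Leaf"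
  by (simp add: tree_leaves_iff)

lemma tree_leaves_Cons:
  "i # v \<in> tree_leaves S \<longleftrightarrow> i < length (children S) \<and> v \<in> tree_leaves (children S ! i)"
  by (auto simp: tree_leaves_iff vertices_Cons)

lemma tree_leaves_right_sided [simp]:
  "i # v \<in> tree_leaves (Node Leaf S []) \<longleftrightarrow> i = 0 \<and> v = [] \<or> i = 1 \<and> v \<in> tree_leaves S"
  by (cases "i - 1"; cases i) (auto simp: tree_leaves_Cons)

lemma no_vertex_below_leaf:
  assumes "b \<in> tree_leaves S" "b @ u \<in> vertices S"
  shows "u = []"
  using assms by (simp add: tree_leaves_iff vertices_append)

text \<open>
  So an address below some leaf of \<open>S\<close> determines this leaf; this keeps the parts of a
  decomposition that belong to different leaves apart.
\<close>

lemma leaf_prefix_unique: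
  assumes "b \<in> tree_leaves S" "b' \<in> tree_leaves S" "b @ u = b' @ u'"
  shows "b = b' \<and> u = u'"
proof -
  obtain c where "b = b' @ c \<or> b' = b @ c"
    using assms(3) by (auto simp: append_eq_append_conv2)
  then have "b = b'"
    using assms(1,2) tree_leaves_subset no_vertex_below_leaf by (metis append_Nil2 subsetD)
  then show ?thesis using assms(3) by simp
qed

text \<open>
  \<open>initial S T\<close> says that \<open>S\<close> sits at the root of \<open>T\<close> as a relatively open subtree. This is the
  relation between \<open>S\<close> and the trees obtained from \<open>S\<close> by grafting.
\<close>

definition initial :: "prt \<Rightarrow> prt \<Rightarrow> bool" where
  "initial S T \<longleftrightarrow> vertices S \<subseteq> vertices T \<and>
     (\<forall>v i j. v @ [i] \<in> vertices S \<longrightarrow> v @ [j] \<in> vertices T \<longrightarrow> v @ [j] \<in> vertices S)"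

lemma finite_initial: "finite {S. initial S T}"
proof (rule inj_on_finite)
  show "inj_on vertices {S. initial S T}" by (auto intro: inj_onI vertices_inject)
  show "vertices ` {S. initial S T} \<subseteq> Pow (vertices T)" by (auto simp: initial_def)
  show "finite (Pow (vertices T))" by (simp add: finite_vertices)
qed

lemma initial_of_Leaf [simp]: "initial Leaf T"
  by (auto simp: initial_def)

lemma initial_in_Leaf [simp]: "initial S Leaf \<longleftrightarrow> S = Leaf"
proof
  assume "initial S Leaf"
  then have "vertices S = vertices Leaf" using vertices_Nil[of S] by (auto simp: initial_def)
  then show "S = Leaf" by (rule vertices_inject)
qed simp

lemma initial_children:
  assumes "S \<noteq> Leaf"
  shows "initial S T \<longleftrightarrow> length (children S) = length (children T) \<and>
    (\<forall>i<length (children S). initial (children S ! i) (children T ! i))"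
proof
  assume S: "initial S T"
  have "i < length (children S) \<longleftrightarrow> i < length (children T)" for i
  proof -
    have "[i] \<in> vertices S \<longleftrightarrow> [i] \<in> vertices T"
    proof -
      have "[0] \<in> vertices S" using assms by (cases S) (auto simp: vertices_Cons)
      then show ?thesis using S unfolding initial_def by (metis append_Nil subsetD)
    qed
    then show ?thesis by (simp add: vertices_Cons)
  qed
  then have len: "length (children S) = length (children T)"
    by (meson linorder_neq_iff)
  moreover have "initial (children S ! i) (children T ! i)" if i: "i < length (children S)" for i
  proof -
    have "i # v \<in> vertices S \<Longrightarrow> i # v \<in> vertices T"
      "i # v @ [j] \<in> vertices S \<Longrightarrow> i # v @ [k] \<in> vertices T \<Longrightarrow> i # v @ [k] \<in> vertices S" for v j k
      using S unfolding initial_def by (blast, metis append_Cons)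
    moreover have "i < length (children T)" using i len by simp
    ultimately show ?thesis using i unfolding initial_def vertices_Cons by blast
  qed
  ultimately show "length (children S) = length (children T) \<and>
    (\<forall>i<length (children S). initial (children S ! i) (children T ! i))" by blast
next
  assume *: "length (children S) = length (children T) \<and>
    (\<forall>i<length (children S). initial (children S ! i) (children T ! i))"
  show "initial S T"
    unfolding initial_def
  proof (intro conjI allI impI subsetI)
    show "v \<in> vertices T" if "v \<in> vertices S" for v
      using that * by (cases v) (auto simp: vertices_Cons initial_def)
    show "v @ [j] \<in> vertices S" if "v @ [i] \<in> vertices S" "v @ [j] \<in> vertices T" for v i j
    proof (cases v)
      case Nil
      then show ?thesis using that * by (simp add: vertices_Cons)
    next
      case (Cons k u)
      then have "initial (children S ! k) (children T ! k)" "u @ [i] \<in> vertices (children S ! k)"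
        "u @ [j] \<in> vertices (children T ! k)" "k < length (children S)"
        using that * by (simp_all add: vertices_Cons)
      then show ?thesis using Cons unfolding initial_def by (simp add: vertices_Cons) blast
    qed
  qed
qed

lemma initial_right_sided [simp]:
  "initial (Node Leaf S []) (Node Leaf T []) \<longleftrightarrow> initial S T"
  by (auto simp: initial_children less_Suc_eq)

text \<open>
  A vertex of \<open>T\<close> outside an initial subtree \<open>S\<close> lies strictly below a leaf of \<open>S\<close>, because \<open>S\<close>
  contains all children of its inner vertices.
\<close>

lemma initial_cases:
  assumes "initial S T" "v \<in> vertices T"
  obtains "v \<in> vertices S" "v \<notin> tree_leaves S"
  | b u where "b \<in> tree_leaves S" "v = b @ u" "u \<in> vertices (branch T b)"
proof -
  have "v \<in> vertices S \<or> (\<exists>b\<in>tree_leaves S. \<exists>u. v = b @ u)"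
    using assms(2)
  proof (induction v rule: rev_induct)
    case (snoc i v)
    then have "v \<in> vertices S \<or> (\<exists>b\<in>tree_leaves S. \<exists>u. v = b @ u)"
      by (simp add: vertices_append)
    then show ?case
    proof
      assume v: "v \<in> vertices S"
      show ?thesis
      proof (cases "v \<in> tree_leaves S")
        case False
        then obtain j where "v @ [j] \<in> vertices S" using v by (auto simp: leaf_vertices_def)
        then show ?thesis using assms(1) snoc.prems unfolding initial_def by blast
      qed blast
    qed (metis append_assoc)
  qed simp
  then consider "v \<in> vertices S" "v \<notin> tree_leaves S" | b u where "b \<in> tree_leaves S" "v = b @ u"
    by (metis append_Nil2)
  then show ?thesis using assms(2) that by cases (auto simp: vertices_append)
qed

lemma initial_leaf_in: "initial S T \<Longrightarrow> b \<in> tree_leaves S \<Longrightarrow> b \<in> vertices T"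
  using tree_leaves_subset by (auto simp: initial_def)


section \<open>Grafting\<close>

text \<open>
  The leaves from left to right, in the order in which \<open>graft\<close> consumes its list. The auxiliary
  function takes the number of the first of the given siblings.
\<close>

fun leaf_list :: "prt \<Rightarrow> vertex list" and leaf_lists :: "nat \<Rightarrow> prt list \<Rightarrow> vertex list" where
  "leaf_list Leaf = [[]]"
| "leaf_list (Node S T Us) =
     map ((#) 0) (leaf_list S) @ map ((#) 1) (leaf_list T) @ leaf_lists 2 Us"
| "leaf_lists n [] = []"
| "leaf_lists n (U # Us) = map ((#) n) (leaf_list U) @ leaf_lists (Suc n) Us"

lemma length_leaf_list:
  "length (leaf_list S) = deg S"
  "length (leaf_lists n Us) = sum_list (map deg Us)"
  by (induction S and n Us rule: leaf_list_leaf_lists.induct) auto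

lemma set_leaf_lists:
  "set (leaf_lists n Us) = (\<Union>i<length Us. (#) (n + i) ` set (leaf_list (Us ! i)))"
proof (induction Us arbitrary: n)
  case (Cons U Us)
  show ?case by (simp add: Cons lessThan_Suc_eq_insert_0 image_image del: image_Suc_lessThan)
qed simp

lemma distinct_leaf_list: "distinct (leaf_list S)" "distinct (leaf_lists n Us)"
  by (induction S and n Us rule: leaf_list_leaf_lists.induct)
    (auto simp: distinct_map set_leaf_lists)

lemma set_leaf_list: "set (leaf_list S) = tree_leaves S"
proof (induction S)
  case (Node A B Us)
  have ch: "set (leaf_list (children (Node A B Us) ! i)) = tree_leaves (children (Node A B Us) ! i)"
    if "i < length (children (Node A B Us))" for i
    using nth_mem[OF that] Node by auto
  have "i # v \<in> set (leaf_list (Node A B Us)) \<longleftrightarrow>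
      i < length (children (Node A B Us)) \<and> v \<in> set (leaf_list (children (Node A B Us) ! i))" for i v
    by (cases i; cases "i - 1") (auto simp: set_leaf_lists)
  then have "i # v \<in> set (leaf_list (Node A B Us)) \<longleftrightarrow> i # v \<in> tree_leaves (Node A B Us)" for i v
    unfolding tree_leaves_Cons using ch by metis
  moreover have "[] \<notin> set (leaf_list (Node A B Us))" by (auto simp: set_leaf_lists)
  ultimately show ?case by (metis list.exhaust prt.distinct(1) subsetI subset_antisym tree_leaves_Nil)
qed simp

lemma length_graft_list: "length (graft_list Us Ts) = length Us"
  by (induction Us arbitrary: Ts) auto

text \<open>
  The grafted list can be read off from the result, so grafting onto a fixed \<open>S\<close> is injective. The
  second part, on a final segment of the children, is what the induction needs.
\<close>

lemma branches_of_graft: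
  "length Ts = deg S \<Longrightarrow> initial S (graft S Ts) \<and> map (branch (graft S Ts)) (leaf_list S) = Ts"
  "length Ts = sum_list (map deg Us) \<Longrightarrow>
     list_all2 initial Us (graft_list Us Ts) \<and>
     (\<forall>n T. drop n (children T) = graft_list Us Ts \<longrightarrow> map (branch T) (leaf_lists n Us) = Ts)"
proof (induction S Ts and Us Ts rule: graft_graft_list.induct)
  case (1 Ts)
  then show ?case by (cases Ts) auto
next
  case (2 S T Us Ts)
  let ?n = "deg S" and ?m = "deg S + deg T"
  have l: "length (take (deg S) Ts) = deg S"
    "length (take (deg T) (drop (deg S) Ts)) = deg T"
    "length (drop ?m Ts) = sum_list (map deg Us)"
    using 2(4) by auto
  note IH = 2(1)[OF l(1)] 2(2)[OF l(2)] 2(3)[OF l(3)]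
  let ?G = "graft (Node S T Us) Ts"
  have "initial (Node S T Us) ?G"
    using IH by (auto simp: initial_children list_all2_conv_all_nth nth_Cons' length_graft_list)
  moreover have "map (branch ?G) (leaf_lists 2 Us) = drop ?m Ts"
    using IH(3) by (simp add: numeral_2_eq_2)
  then have "map (branch ?G) (leaf_list (Node S T Us)) =
      take (deg S) Ts @ take (deg T) (drop (deg S) Ts) @ drop ?m Ts"
    using IH by (simp add: comp_def)
  then have "map (branch ?G) (leaf_list (Node S T Us)) = Ts"
    by (metis add.commute append_take_drop_id drop_drop)
  ultimately show ?case by blast
next
  case (3 Ts)
  then show ?case by simp
next
  case (4 U Us Ts)
  have l: "length (take (deg U) Ts) = deg U"
    "length (drop (deg U) Ts) = sum_list (map deg Us)"
    using 4(3) by auto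
  note IH = 4(1)[OF l(1)] 4(2)[OF l(2)]
  have "map (branch T) (leaf_lists n (U # Us)) = Ts" if n: "drop n (children T) = graft_list (U # Us) Ts" for n T
  proof -
    have "n < length (children T)" using n by (metis drop_eq_Nil2 graft_list.simps(2) leI list.distinct(1))
    then have "children T ! n = graft U (take (deg U) Ts)"
      "drop (Suc n) (children T) = graft_list Us (drop (deg U) Ts)"
      using n by (simp_all add: Cons_nth_drop_Suc[symmetric])
    then show ?thesis using IH by (simp add: comp_def)
  qed
  then show ?case using IH by simp
qed

lemma graft_branches:
  "initial S T \<Longrightarrow> graft S (map (branch T) (leaf_list S)) = T"
proof (induction S arbitrary: T)
  case (Node A B Us)
  obtain A' B' Us' where T: "T = Node A' B' Us'" and len: "length Us' = length Us"
    using Node.prems by (cases T) (auto simp: initial_children)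
  have ini: "initial (children (Node A B Us) ! i) (children T ! i)" if "i < length Us + 2" for i
    using Node.prems that by (simp add: initial_children)
  (* Us is the list of children from number 2 on; the claim is proved for every final segment Vs of
     it, whose first tree is child number n. *)
  have "graft_list Vs (map (branch T) (leaf_lists n Vs)) = drop n (children T)"
    if "n + length Vs = length (children T)" "drop (n - 2) Us = Vs" "n \<ge> 2" for n Vs
    using that
  proof (induction Vs arbitrary: n)
    case (Cons V Vs)
    have n: "n < length (children T)" "n - 2 < length Us" using Cons.prems len T by auto
    have V: "V = Us ! (n - 2)" "Vs = drop (Suc n - 2) Us"
    proof -
      have "Suc n - 2 = Suc (n - 2)" using Cons.prems by simp
      then show "V = Us ! (n - 2)" "Vs = drop (Suc n - 2) Us"
        using Cons.prems(2) n(2) by (simp_all only: Cons_nth_drop_Suc[symmetric] list.inject)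
    qed
    have "initial V (children T ! n)"
      using ini[of n] n Cons.prems V T by (cases n; cases "n - 1") auto
    then have "graft V (map (branch (children T ! n)) (leaf_list V)) = children T ! n"
      using Node.IH(3) V n by simp
    moreover have "graft_list Vs (map (branch T) (leaf_lists (Suc n) Vs)) = drop (Suc n) (children T)"
      using Cons V by auto
    ultimately show ?case
      using n by (simp add: comp_def length_leaf_list Cons_nth_drop_Suc)
  qed simp
  from this[of 2 Us]
  have "graft_list Us (map (branch T) (leaf_lists 2 Us)) = Us'" using T len by simp
  moreover have "graft A (map (branch A') (leaf_list A)) = A'" "graft B (map (branch B') (leaf_list B)) = B'"
    using Node.IH ini[of 0] ini[of 1] T by auto
  ultimately show ?case using T by (simp add: comp_def length_leaf_list)
qed simp

lemma graft_eq_iff: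
  "{Ts. length Ts = deg S \<and> graft S Ts = T} =
     (if initial S T then {map (branch T) (leaf_list S)} else {})"
  using branches_of_graft(1)[of _ S] graft_branches[of S T] by (auto simp: length_leaf_list)

text \<open>
  Each initial subtree \<open>S\<close> of \<open>T\<close> contributes through exactly one list of grafted trees, and no other
  tree contributes at all.
\<close>

lemma series_subst_Some:
  fixes f g :: "'k::field tree_series"
  shows "series_subst f g (Some T) =
    (\<Sum>S | initial S T. f (Some S) * (\<Prod>b\<in>tree_leaves S. g (Some (branch T b))))"
proof -
  have sub: "tree_subst (Some S) g (Some T) =
    (if initial S T then \<Prod>b\<in>tree_leaves S. g (Some (branch T b)) else 0)" for S
    by (simp add: graft_eq_iff comp_def distinct_leaf_list
        prod.distinct_set_conv_list set_leaf_list[symmetric])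
  have "series_subst f g (Some T) =
      (\<Sum>S'\<in>Some ` {S. initial S T}. f S' * tree_subst S' g (Some T))"
    unfolding series_subst_def
  proof (rule Sum_any.expand_superset)
    show "{S'. f S' * tree_subst S' g (Some T) \<noteq> 0} \<subseteq> Some ` {S. initial S T}"
    proof
      fix S' assume "S' \<in> {S'. f S' * tree_subst S' g (Some T) \<noteq> 0}"
      then have nz: "tree_subst S' g (Some T) \<noteq> 0" by auto
      show "S' \<in> Some ` {S. initial S T}"
        using nz sub by (cases S') (auto simp del: tree_subst.simps(2) split: if_splits)
    qed
  qed (simp add: finite_initial)
  also have "\<dots> = (\<Sum>S | initial S T. f (Some S) * tree_subst (Some S) g (Some T))"
    by (simp add: sum.reindex del: tree_subst.simps)
  finally show ?thesis using sub by (simp del: tree_subst.simps)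
qed

lemma series_subst_None: "series_subst f g None = f None"
proof -
  have "series_subst f g None = (\<Sum>S'\<in>{None}. f S' * tree_subst S' g None)"
    unfolding series_subst_def
  proof (rule Sum_any.expand_superset)
    show "{S'. f S' * tree_subst S' g None \<noteq> 0} \<subseteq> {None}"
    proof
      fix S' assume "S' \<in> {S'. f S' * tree_subst S' g None \<noteq> 0}"
      then show "S' \<in> {None}" by (cases S') auto
    qed
  qed simp
  then show ?thesis by simp
qed

lemma series_mult_x:
  "series_mult series_x h (Some T) = (if right_sided T then h (right_part T) else 0)"
proof -
  have 1: "{(R, S). R = Some Leaf \<and> tree_mult R S = Some T} =
      (if right_sided T then {(Some Leaf, right_part T)} else {})"
  proof -
    have "tree_mult (Some Leaf) S = Some T \<longleftrightarrow> right_sided T \<and> S = right_part T" for S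
      unfolding eq_commute[of _ "Some T"] tree_mult_Leaf by (cases T) (auto split: option.splits)
    then show ?thesis by auto
  qed
  have "series_mult series_x h (Some T) =
      (\<Sum>(R, S)\<in>{(R, S). R = Some Leaf \<and> tree_mult R S = Some T}. series_x R * h S)"
    unfolding series_mult_def
    by (rule sum.mono_neutral_right[OF finite_tree_mult]) (auto simp: series_x_def split: if_splits)
  then show ?thesis unfolding 1 by (simp add: series_x_def)
qed


section \<open>Pieces\<close>

text \<open>
  The relatively open subtrees of \<open>T\<close> are exactly
  the pieces \<open>piece r S\<close> with \<open>S\<close> initial in the branch of \<open>T\<close> at \<open>r\<close>, and such a piece determines
  \<open>r\<close> and \<open>S\<close>.
\<close>

definition piece :: "vertex \<Rightarrow> prt \<Rightarrow> vertex set" where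
  "piece r S = (@) r ` vertices S"

lemma append_in_piece [simp]: "r @ v \<in> piece r S \<longleftrightarrow> v \<in> vertices S"
  by (auto simp: piece_def)

lemma root_in_piece [simp]: "r \<in> piece r S"
  using append_in_piece[of r "[]" S] by simp

lemma root_vertex_piece [simp]: "root_vertex (piece r S) = r"
proof -
  have "root_vertex (piece r S) \<in> piece r S"
    unfolding root_vertex_def by (rule arg_min_natI[of _ r]) simp
  moreover have "length (root_vertex (piece r S)) \<le> length r"
    unfolding root_vertex_def by (rule arg_min_nat_le) simp
  ultimately show ?thesis by (auto simp: piece_def)
qed

lemma induced_tree_piece [simp]: "induced_tree (piece r S) = S"
proof -
  have "S' = S" if "piece r S = (@) r ` vertices S'" for S'
    using that by (auto simp: piece_def inj_image_eq_iff inj_on_def intro: vertices_inject)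
  then show ?thesis
    unfolding induced_tree_def root_vertex_piece by (intro the_equality) (auto simp: piece_def)
qed

lemma piece_inject [simp]: "piece r S = piece r' S' \<longleftrightarrow> r = r' \<and> S = S'"
  by (metis root_vertex_piece induced_tree_piece)

lemma leaf_vertices_piece: "leaf_vertices (piece r S) = (@) r ` tree_leaves S"
proof (intro equalityI subsetI)
  fix v assume v: "v \<in> leaf_vertices (piece r S)"
  then obtain w where w: "v = r @ w" "w \<in> vertices S"
    by (auto simp: leaf_vertices_def piece_def)
  have "w @ [i] \<notin> vertices S" for i
    using v w append_in_piece[of r "w @ [i]" S] by (auto simp: leaf_vertices_def)
  then show "v \<in> (@) r ` tree_leaves S" using w by (auto simp: leaf_vertices_def)
qed (auto simp: leaf_vertices_def)

lemma first_leaf_piece [simp]: "first_leaf (piece r S) = r @ leftmost_leaf S"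
  by (simp add: first_leaf_def)

lemma piece_singleton: "piece r S = {v} \<longleftrightarrow> S = Leaf \<and> v = r"
proof -
  have "piece v Leaf = {v}" by (simp add: piece_def)
  then show ?thesis using piece_inject[of r S v Leaf] by auto
qed

lemma connected_piece: "connected_on (piece r S)"
proof -
  let ?U = "piece r S"
  let ?E = "edges_on ?U \<union> (edges_on ?U)\<inverse>"
  have "(r, r @ v) \<in> ?E\<^sup>*" if "v \<in> vertices S" for v
    using that
  proof (induction v rule: rev_induct)
    case (snoc i v)
    then have v: "v \<in> vertices S" by (simp add: vertices_append)
    then have "(r @ v, r @ v @ [i]) \<in> ?E"
      using snoc.prems by (auto simp: edges_on_def)
    then show ?case using snoc.IH[OF v] by (rule rtrancl_into_rtrancl[rotated])
  qed simp
  then have "(r, v) \<in> ?E\<^sup>*" if "v \<in> ?U" for v using that by (auto simp: piece_def)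
  moreover have "sym (?E\<^sup>*)" by (intro sym_rtrancl) (auto simp: sym_def)
  ultimately show ?thesis unfolding connected_on_def by (meson rtrancl_trans symD)
qed

lemma piece_subset:
  "r \<in> vertices T \<Longrightarrow> initial S (branch T r) \<Longrightarrow> piece r S \<subseteq> vertices T"
  by (auto simp: piece_def vertices_append initial_def)

lemma rel_open_subtree_iff:
  "rel_open_subtree T U \<longleftrightarrow> (\<exists>r S. U = piece r S \<and> r \<in> vertices T \<and> initial S (branch T r))"
proof
  assume U: "rel_open_subtree T U"
  obtain r S where S: "U = piece r S"
    using induced_tree[OF U] by (auto simp: piece_def)
  have sub: "U \<subseteq> vertices T" using U by (simp add: rel_open_subtree_def)
  have open': "\<forall>v\<in>U. (\<exists>i. v @ [i] \<in> U) \<longrightarrow> (\<forall>i. v @ [i] \<in> vertices T \<longrightarrow> v @ [i] \<in> U)"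
    using U unfolding rel_open_subtree_def by (elim conjE)
  have opn: "v @ [j] \<in> U" if "v \<in> U" "v @ [i] \<in> U" "v @ [j] \<in> vertices T" for v i j
    by (rule open'[rule_format, OF that(1) _ that(3)]) (rule exI, rule that(2))
  have r: "r \<in> vertices T" using sub S root_in_piece by blast
  have "initial S (branch T r)"
    unfolding initial_def
  proof (intro conjI allI impI subsetI)
    show "v \<in> vertices (branch T r)" if "v \<in> vertices S" for v
    proof -
      have "r @ v \<in> U" using that by (simp add: S)
      then show ?thesis using sub by (auto simp: vertices_append)
    qed
    show "v @ [j] \<in> vertices S"
      if "v @ [i] \<in> vertices S" "v @ [j] \<in> vertices (branch T r)" for v i j
    proof -
      have "v \<in> vertices S" using that(1) by (simp add: vertices_append)
      then have "r @ v \<in> U" "(r @ v) @ [i] \<in> U" using that(1) by (simp_all add: S)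
      moreover have "(r @ v) @ [j] \<in> vertices T"
        using that(2) r by (simp add: vertices_append branch_append)
      ultimately have "r @ v @ [j] \<in> U" using opn by fastforce
      then show ?thesis by (simp add: S)
    qed
  qed
  then show "\<exists>r S. U = piece r S \<and> r \<in> vertices T \<and> initial S (branch T r)"
    using S r by blast
next
  assume "\<exists>r S. U = piece r S \<and> r \<in> vertices T \<and> initial S (branch T r)"
  then obtain r S where U: "U = piece r S" "r \<in> vertices T" and S: "initial S (branch T r)" by blast
  have "U \<subseteq> vertices T" using U S piece_subset by simp
  moreover have "v @ [j] \<in> U" if vij: "v \<in> U" "v @ [i] \<in> U" "v @ [j] \<in> vertices T" for v i j
  proof -
    obtain w where v: "v = r @ w" using vij(1) U(1) by (auto simp: piece_def)
    have "w @ [i] \<in> vertices S" "w @ [j] \<in> vertices (branch T r)"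
      using vij U v by (simp_all add: vertices_append)
    then have "w @ [j] \<in> vertices S" using S unfolding initial_def by blast
    then show ?thesis using U v by simp
  qed
  moreover have "U \<noteq> {}" using U root_in_piece by blast
  ultimately show "rel_open_subtree T U"
    using connected_piece U(1) unfolding rel_open_subtree_def by blast
qed


section \<open>Decompositions as tilings\<close>

text \<open>
  Distinct members of a decomposition have distinct roots, so a decomposition is a partial function
  \<open>m\<close> that maps the root of every member to its shape. In this form, restricting a decomposition to
  a branch of the tree is composition of \<open>m\<close> with the map that prefixes the address of the branch.

  The last condition below replaces the one on intersections: two pieces can only meet if the root
  of one of them is a vertex of the other, and then this vertex must be a leaf of the latter.
\<close>

definition tiling :: "prt \<Rightarrow> (vertex \<rightharpoonup> prt) \<Rightarrow> bool" where
  "tiling T m \<longleftrightarrow>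
     (\<forall>r S. m r = Some S \<longrightarrow> r \<in> vertices T \<and> initial S (branch T r) \<and> right_sided S) \<and>
     m [] \<noteq> None \<and>
     (\<forall>v i. v @ [i] \<in> vertices T \<longrightarrow> (\<exists>r S w. m r = Some S \<and> v = r @ w \<and> w @ [i] \<in> vertices S)) \<and>
     (\<forall>r S b. m r = Some S \<longrightarrow> S \<noteq> Leaf \<longrightarrow> b \<in> tree_leaves S \<longrightarrow>
        (m (r @ b) \<noteq> None \<longleftrightarrow> b \<noteq> leftmost_leaf S)) \<and>
     (\<forall>r S w. m r = Some S \<longrightarrow> w \<in> vertices S \<longrightarrow> w \<noteq> [] \<longrightarrow> m (r @ w) \<noteq> None \<longrightarrow> w \<in> tree_leaves S)"

lemma tilingD:
  assumes "tiling T m"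
  shows "m r = Some S \<Longrightarrow> r \<in> vertices T"
    and "m r = Some S \<Longrightarrow> initial S (branch T r)"
    and "m r = Some S \<Longrightarrow> right_sided S"
    and "\<exists>S. m [] = Some S"
    and "v @ [i] \<in> vertices T \<Longrightarrow> \<exists>r S w. m r = Some S \<and> v = r @ w \<and> w @ [i] \<in> vertices S"
    and "m r = Some S \<Longrightarrow> S \<noteq> Leaf \<Longrightarrow> b \<in> tree_leaves S \<Longrightarrow>
      m (r @ b) \<noteq> None \<longleftrightarrow> b \<noteq> leftmost_leaf S"
    and "m r = Some S \<Longrightarrow> w \<in> vertices S \<Longrightarrow> w \<noteq> [] \<Longrightarrow> m (r @ w) \<noteq> None \<Longrightarrow> w \<in> tree_leaves S"
proof -
  note c = assms[unfolded tiling_def]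
  note c1 = c[THEN conjunct1] and c2 = c[THEN conjunct2]
  note c3 = c2[THEN conjunct2] note c4 = c3[THEN conjunct2] note c5 = c4[THEN conjunct2]
  show "m r = Some S \<Longrightarrow> r \<in> vertices T" "m r = Some S \<Longrightarrow> initial S (branch T r)"
    "m r = Some S \<Longrightarrow> right_sided S"
    using c1 by simp_all
  show "\<exists>S. m [] = Some S" using c2[THEN conjunct1] by simp
  show "v @ [i] \<in> vertices T \<Longrightarrow> \<exists>r S w. m r = Some S \<and> v = r @ w \<and> w @ [i] \<in> vertices S"
    using c3[THEN conjunct1] by (elim allE impE)
  show "m r = Some S \<Longrightarrow> S \<noteq> Leaf \<Longrightarrow> b \<in> tree_leaves S \<Longrightarrow>
      m (r @ b) \<noteq> None \<longleftrightarrow> b \<noteq> leftmost_leaf S"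
    using c4[THEN conjunct1] by (elim allE impE)
  show "m r = Some S \<Longrightarrow> w \<in> vertices S \<Longrightarrow> w \<noteq> [] \<Longrightarrow> m (r @ w) \<noteq> None \<Longrightarrow> w \<in> tree_leaves S"
    using c5 by (elim allE impE)
qed

definition members :: "(vertex \<rightharpoonup> prt) \<Rightarrow> vertex set set" where
  "members m = (\<lambda>r. piece r (the (m r))) ` dom m"

lemma members_iff: "U \<in> members m \<longleftrightarrow> (\<exists>r S. m r = Some S \<and> U = piece r S)"
  by (force simp: members_def dom_def)

lemma ball_members: "(\<forall>U\<in>members m. P U) \<longleftrightarrow> (\<forall>r S. m r = Some S \<longrightarrow> P (piece r S))"
  by (auto simp: members_iff)

lemma bex_members: "(\<exists>U\<in>members m. P U) \<longleftrightarrow> (\<exists>r S. m r = Some S \<and> P (piece r S))"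
  unfolding Bex_def members_iff by blast

lemma pieces_meet:
  assumes "v \<in> piece r S" "v \<in> piece r' S'"
  obtains w where "r' = r @ w" "w \<in> vertices S" | w where "r = r' @ w" "w \<in> vertices S'"
proof -
  obtain w w' where "v = r @ w" "v = r' @ w'" "w \<in> vertices S" "w' \<in> vertices S'"
    using assms unfolding piece_def by blast
  then show ?thesis using that by (auto simp: append_eq_append_conv2 vertices_append)
qed

lemma piece_inter_at_leaf:
  assumes "w \<in> tree_leaves S"
  shows "piece r S \<inter> piece (r @ w) S' = {r @ w}"
  using assms tree_leaves_subset no_vertex_below_leaf[OF assms] by (fastforce simp: piece_def)

text \<open>
  If two pieces meet, the root of one lies in the other. So the condition on
  intersections only says that a
  vertex of a member other than its root and its leaves is not the root of a member.
\<close>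

lemma piece_intersections_iff:
  "(\<forall>U\<in>members m. \<forall>U'\<in>members m. U \<inter> U' \<noteq> {} \<and> U \<noteq> U' \<longrightarrow>
      (\<exists>a. U \<inter> U' = {a} \<and>
        (a \<noteq> root_vertex U \<longrightarrow> a \<in> leaf_vertices U \<and> a = root_vertex U'))) \<longleftrightarrow>
   (\<forall>r S w. m r = Some S \<longrightarrow> w \<in> vertices S \<longrightarrow> w \<noteq> [] \<longrightarrow> m (r @ w) \<noteq> None \<longrightarrow> w \<in> tree_leaves S)"
  (is "?L \<longleftrightarrow> ?R")
proof
  assume ?L
  show ?R
  proof (intro allI impI)
    fix r S w assume m: "m r = Some S" "m (r @ w) \<noteq> None" and w: "w \<in> vertices S" "w \<noteq> []"
    then obtain S' where "m (r @ w) = Some S'" by auto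
    then have mem: "piece r S \<in> members m" "piece (r @ w) S' \<in> members m"
      using m by (auto simp: members_iff)
    have meet: "r @ w \<in> piece r S \<inter> piece (r @ w) S'" using w by simp
    then have ne: "piece r S \<inter> piece (r @ w) S' \<noteq> {}" by blast
    have "piece r S \<noteq> piece (r @ w) S'" using w by simp
    with ne have "piece r S \<inter> piece (r @ w) S' \<noteq> {} \<and> piece r S \<noteq> piece (r @ w) S'" ..
    from \<open>?L\<close>[THEN bspec, OF mem(1), THEN bspec, OF mem(2), THEN mp, OF this]
    obtain a where a: "piece r S \<inter> piece (r @ w) S' = {a}"
      "a \<noteq> r \<longrightarrow> a \<in> leaf_vertices (piece r S) \<and> a = r @ w"
      unfolding root_vertex_piece by (elim exE conjE)
    then have "a = r @ w" using meet by blast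
    then show "w \<in> tree_leaves S" using a(2) w by (auto simp: leaf_vertices_piece)
  qed
next
  assume R: ?R
  show ?L
    unfolding ball_members
  proof (intro allI impI)
    fix r S r' S'
    assume m: "m r = Some S" "m r' = Some S'"
      and "piece r S \<inter> piece r' S' \<noteq> {} \<and> piece r S \<noteq> piece r' S'"
    then have "r \<noteq> r'" and "piece r S \<inter> piece r' S' \<noteq> {}" using m by auto
    then obtain v where v: "v \<in> piece r S" "v \<in> piece r' S'" by blast
    from v show "\<exists>a. piece r S \<inter> piece r' S' = {a} \<and>
        (a \<noteq> root_vertex (piece r S) \<longrightarrow> a \<in> leaf_vertices (piece r S) \<and> a = root_vertex (piece r' S'))"
    proof (cases rule: pieces_meet)
      case (1 w)
      then have "w \<in> tree_leaves S" using R m \<open>r \<noteq> r'\<close> by auto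
      then show ?thesis using 1 piece_inter_at_leaf[of w S r S'] by (auto simp: leaf_vertices_piece)
    next
      case (2 w)
      then have "w \<in> tree_leaves S'" using R m \<open>r \<noteq> r'\<close> by auto
      then show ?thesis using 2 piece_inter_at_leaf[of w S' r' S] by (auto simp: Int_commute)
    qed
  qed
qed

lemma edges_subset_iff:
  "edges_on (vertices T) \<subseteq> E \<longleftrightarrow> (\<forall>v i. v @ [i] \<in> vertices T \<longrightarrow> (v, v @ [i]) \<in> E)"
proof
  assume sub: "edges_on (vertices T) \<subseteq> E"
  have "(v, v @ [i]) \<in> edges_on (vertices T)" if "v @ [i] \<in> vertices T" for v i
    using that vertices_append[of v "[i]" T] by (simp add: edges_on_def)
  with sub show "\<forall>v i. v @ [i] \<in> vertices T \<longrightarrow> (v, v @ [i]) \<in> E"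
    by (metis subsetD)
next
  assume "\<forall>v i. v @ [i] \<in> vertices T \<longrightarrow> (v, v @ [i]) \<in> E"
  then show "edges_on (vertices T) \<subseteq> E" by (auto simp: edges_on_def)
qed

lemma edge_cover_iff:
  assumes "\<And>r S. m r = Some S \<Longrightarrow> piece r S \<subseteq> vertices T"
  shows "(\<Union>U\<in>members m. edges_on U) = edges_on (vertices T) \<longleftrightarrow>
    (\<forall>v i. v @ [i] \<in> vertices T \<longrightarrow> (\<exists>r S w. m r = Some S \<and> v = r @ w \<and> w @ [i] \<in> vertices S))"
proof -
  have edge: "(v, v @ [i]) \<in> edges_on (piece r S) \<longleftrightarrow> (\<exists>w. v = r @ w \<and> w @ [i] \<in> vertices S)" for v i r S
    by (auto simp: edges_on_def piece_def vertices_append)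
  have edges: "edges_on (piece r S) \<subseteq> edges_on (vertices T)" if "m r = Some S" for r S
    using assms[OF that] by (auto simp: edges_on_def)
  have "(\<Union>U\<in>members m. edges_on U) \<subseteq> edges_on (vertices T)"
  proof (rule UN_least)
    fix U assume "U \<in> members m"
    then obtain r S where "m r = Some S" "U = piece r S" unfolding members_iff by blast
    then show "edges_on U \<subseteq> edges_on (vertices T)"
      using edges by simp
  qed
  moreover have "edges_on (vertices T) \<subseteq> (\<Union>U\<in>members m. edges_on U) \<longleftrightarrow>
    (\<forall>v i. v @ [i] \<in> vertices T \<longrightarrow> (v, v @ [i]) \<in> (\<Union>U\<in>members m. edges_on U))"
    by (rule edges_subset_iff)
  ultimately have "(\<Union>U\<in>members m. edges_on U) = edges_on (vertices T) \<longleftrightarrow>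
    (\<forall>v i. v @ [i] \<in> vertices T \<longrightarrow> (v, v @ [i]) \<in> (\<Union>U\<in>members m. edges_on U))"
    by (simp only: set_eq_subset simp_thms)
  then show ?thesis unfolding UN_iff bex_members edge by simp
qed

text \<open>
  The pieces cover all vertices as soon as they cover all edges and the root, since every other
  vertex is the lower end of an edge.
\<close>

lemma decomposition_members_iff: "right_sided_decomposition T (members m) \<longleftrightarrow> tiling T m"
proof -
  have distinct_roots: "\<forall>U\<in>members m. \<forall>U'\<in>members m. U \<noteq> U' \<longrightarrow> root_vertex U \<noteq> root_vertex U'"
    by (auto simp: members_iff)
  have shapes: "(\<forall>U\<in>members m. rel_open_subtree T U \<and> right_sided (induced_tree U)) \<longleftrightarrow>
    (\<forall>r S. m r = Some S \<longrightarrow> r \<in> vertices T \<and> initial S (branch T r) \<and> right_sided S)"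
    unfolding ball_members rel_open_subtree_iff by auto
  have leaves: "(\<forall>U\<in>members m. \<forall>b\<in>leaf_vertices U. U \<noteq> {b} \<longrightarrow>
        ((\<exists>U'\<in>members m. root_vertex U' = b) \<longleftrightarrow> b \<noteq> first_leaf U)) \<longleftrightarrow>
    (\<forall>r S b. m r = Some S \<longrightarrow> S \<noteq> Leaf \<longrightarrow> b \<in> tree_leaves S \<longrightarrow>
        (m (r @ b) \<noteq> None \<longleftrightarrow> b \<noteq> leftmost_leaf S))"
  proof -
    have "piece r S \<noteq> {r @ b} \<longleftrightarrow> S \<noteq> Leaf" if "b \<in> tree_leaves S" for r S b
      using that by (auto simp: piece_singleton)
    then show ?thesis
      unfolding ball_members bex_members leaf_vertices_piece by (simp cong: ball_cong) blast
  qed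
  have cover: "(\<Union>U\<in>members m. U) = vertices T \<and>
      (\<Union>U\<in>members m. edges_on U) = edges_on (vertices T) \<longleftrightarrow>
    m [] \<noteq> None \<and>
    (\<forall>v i. v @ [i] \<in> vertices T \<longrightarrow> (\<exists>r S w. m r = Some S \<and> v = r @ w \<and> w @ [i] \<in> vertices S))"
    if shape: "\<forall>r S. m r = Some S \<longrightarrow> r \<in> vertices T \<and> initial S (branch T r) \<and> right_sided S"
  proof -
    have sub: "piece r S \<subseteq> vertices T" if "m r = Some S" for r S
      using shape that by (simp add: piece_subset)
    have "(\<Union>U\<in>members m. U) = vertices T \<longleftrightarrow> m [] \<noteq> None"
      if e: "\<forall>v i. v @ [i] \<in> vertices T \<longrightarrow> (\<exists>r S w. m r = Some S \<and> v = r @ w \<and> w @ [i] \<in> vertices S)"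
    proof
      assume "(\<Union>U\<in>members m. U) = vertices T"
      then have "[] \<in> (\<Union>U\<in>members m. U)" by simp
      then show "m [] \<noteq> None" by (auto simp: members_iff piece_def)
    next
      assume "m [] \<noteq> None"
      have "\<exists>U\<in>members m. v \<in> U" if v: "v \<in> vertices T" for v
      proof (cases v rule: rev_cases)
        case Nil
        then show ?thesis using \<open>m [] \<noteq> None\<close> root_in_piece[of "[]"] unfolding bex_members by fastforce
      next
        case (snoc u i)
        then obtain r S w where "m r = Some S" "u = r @ w" "w @ [i] \<in> vertices S"
          using e v by blast
        then have "m r = Some S \<and> v \<in> piece r S" using snoc by simp
        then show ?thesis unfolding bex_members by blast
      qed
      moreover have "U \<subseteq> vertices T" if "U \<in> members m" for U
        using that sub unfolding members_iff by blast
      ultimately show "(\<Union>U\<in>members m. U) = vertices T" by blast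
    qed
    from rev_conj_cong[OF edge_cover_iff[OF sub] this] show ?thesis .
  qed
  have "(A \<and> B \<and> C \<and> D \<and> E \<and> F) = (A \<and> B' \<and> C' \<and> D \<and> E)"
    if "A \<Longrightarrow> (B \<and> C) = (B' \<and> C')" F for A B C D E F B' C'
    using that by blast
  from this[OF cover distinct_roots] show ?thesis
    unfolding right_sided_decomposition_def tiling_def shapes leaves piece_intersections_iff .
qed

lemma decomposition_is_members:
  assumes "right_sided_decomposition T Q"
  shows "\<exists>m. Q = members m"
proof
  have pieces: "\<forall>U\<in>Q. rel_open_subtree T U"
    and roots: "\<forall>U\<in>Q. \<forall>U'\<in>Q. U \<noteq> U' \<longrightarrow> root_vertex U \<noteq> root_vertex U'"
    using assms by (simp_all add: right_sided_decomposition_def)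
  define m where "m r = (if \<exists>S. piece r S \<in> Q then Some (SOME S. piece r S \<in> Q) else None)" for r
  have "m r = Some S \<longleftrightarrow> piece r S \<in> Q" for r S
  proof -
    have "S = S'" if "piece r S \<in> Q" "piece r S' \<in> Q" for S S'
      using roots that by (metis piece_inject root_vertex_piece)
    then show ?thesis unfolding m_def by (auto intro: someI some_equality)
  qed
  moreover have "\<exists>r S. U = piece r S" if "U \<in> Q" for U
    using pieces that by (auto simp: rel_open_subtree_iff)
  ultimately have "U \<in> Q \<longleftrightarrow> U \<in> members m" for U unfolding members_iff by blast
  then show "Q = members m" by blast
qed

lemma inj_members: "inj members"
proof (rule injI, rule ext)
  fix m m' :: "vertex \<rightharpoonup> prt" and r
  assume eq: "members m = members m'"
  have "m r = Some S \<longleftrightarrow> m' r = Some S" for S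
  proof -
    have "m r = Some S \<longleftrightarrow> piece r S \<in> members m" "m' r = Some S \<longleftrightarrow> piece r S \<in> members m'"
      by (auto simp: members_iff)
    then show ?thesis using eq by simp
  qed
  then show "m r = m' r" by (metis not_Some_eq)
qed

lemma bij_members: "bij_betw members {m. tiling T m} (right_sided_decompositions T)"
proof (rule bij_betw_imageI)
  show "members ` {m. tiling T m} = right_sided_decompositions T"
    using decomposition_members_iff decomposition_is_members
    unfolding right_sided_decompositions_def by fast
qed (rule inj_on_subset[OF inj_members subset_UNIV])

lemma finite_tilings: "finite {m. tiling T m}"
  using bij_betw_finite[OF bij_members] finite_right_sided_decompositions(1) by blast

lemma finite_dom_tiling: "tiling T m \<Longrightarrow> finite (dom m)"
  using tilingD(1) by (auto intro!: finite_subset[OF _ finite_vertices[of T]])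

definition tiling_coeff :: "'k::field tree_series \<Rightarrow> (vertex \<rightharpoonup> prt) \<Rightarrow> 'k" where
  "tiling_coeff f m = (\<Prod>r\<in>dom m. f (right_part (the (m r))))"

lemma decomposition_coeff_members: "decomposition_coeff f (members m) = tiling_coeff f m"
  unfolding decomposition_coeff_def tiling_coeff_def members_def
  by (subst prod.reindex) (auto simp: inj_on_def)

lemma sum_decompositions:
  "(\<Sum>Q\<in>right_sided_decompositions T. decomposition_coeff f Q) = (\<Sum>m | tiling T m. tiling_coeff f m)"
  using sum.reindex_bij_betw[OF bij_members, of "decomposition_coeff f" T]
  by (simp add: decomposition_coeff_members)


section \<open>Recursion for tilings\<close>

text \<open>
  Let \<open>T\<close> have more than one vertex. The member at the root is not a single vertex, because it is the
  only one that can contain the edges at the root. So \<open>T\<close> has two children, and the first one is the first leaf of this member.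
  It is not the root of another member, hence nothing lies below it.
\<close>

lemma tiling_right_sided:
  assumes m: "tiling T m"
  shows "right_sided T"
proof (cases T)
  case (Node A B Us)
  obtain S where S: "m [] = Some S" using tilingD(4)[OF m] by blast
  have "[] @ [0] \<in> vertices T" using Node by (simp add: vertices_Cons)
  then obtain r S' w where "m r = Some S'" "[] = r @ w" "w @ [0] \<in> vertices S'"
    using tilingD(5)[OF m, of "[]" 0] by blast
  then have "S \<noteq> Leaf" using S by auto
  then obtain S1 where S1: "S = Node Leaf S1 []" using tilingD(3)[OF m S] by (cases S) auto
  then have Us: "Us = []" using tilingD(2)[OF m S] Node by (simp add: initial_children)
  have "A = Leaf"
  proof (rule ccontr)
    assume "A \<noteq> Leaf"
    then have "[0] @ [0] \<in> vertices T" using Node by (cases A) (auto simp: vertices_Cons)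
    then obtain r S' w where r: "m r = Some S'" "[0] = r @ w" "w @ [0] \<in> vertices S'"
      using tilingD(5)[OF m] by blast
    then have "r = [] \<or> r = [0]" by (cases r) auto
    then show False
    proof
      assume "r = []"
      then have "w = [0]" "S' = S" using r S by auto
      then show False using r(3) S1 by simp
    next
      assume "r = [0]"
      then show False using r(1) tilingD(6)[OF m S, of "[0]"] S1 by simp
    qed
  qed
  then show ?thesis using Node Us by simp
qed simp

lemma tilings_Leaf: "{m. tiling Leaf m} = {[[] \<mapsto> Leaf]}"
proof -
  have "m = [[] \<mapsto> Leaf]" if m: "tiling Leaf m" for m
  proof
    fix r
    show "m r = [[] \<mapsto> Leaf] r"
    proof (cases "r = []")
      case True
      then show ?thesis using tilingD(2,4)[OF m] by fastforce
    next
      case False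
      then show ?thesis using tilingD(1)[OF m, of r] by (cases "m r") auto
    qed
  qed
  moreover have "tiling Leaf [[] \<mapsto> Leaf]" by (auto simp: tiling_def split: if_splits)
  ultimately show ?thesis by blast
qed

text \<open>
  In \<open>x\<cdot>T\<close> the first leaf has address \<open>[0]\<close>, and \<open>T\<close> is the branch at \<open>[1]\<close>. The root of a member
  below the root of \<open>x\<cdot>T\<close> can neither be \<open>[0]\<close>, which is the first leaf of the member \<open>x\<cdot>S\<close> at the
  root, nor an inner vertex of \<open>x\<cdot>S\<close>. So it lies at or below a leaf of \<open>S\<close>, and the members
  split into one tiling for each of these leaves.
\<close>

lemma tiling_right_sidedD:
  assumes m: "tiling (Node Leaf T []) m"
  obtains S where "initial S T" "m [] = Some (Node Leaf S [])"
    "\<And>b. b \<in> tree_leaves S \<Longrightarrow> tiling (branch T b) (\<lambda>u. m (1 # b @ u))"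
    "\<And>r. r \<in> dom m \<Longrightarrow> r \<noteq> [] \<Longrightarrow> \<exists>b\<in>tree_leaves S. \<exists>u. r = 1 # b @ u"
proof -
  let ?T = "Node Leaf T []"
  obtain S0 where S0: "m [] = Some S0" using tilingD(4)[OF m] by blast
  have "[] @ [0] \<in> vertices ?T" by simp
  then obtain r S' w where "m r = Some S'" "[] = r @ w" "w @ [0] \<in> vertices S'"
    using tilingD(5)[OF m, of "[]" 0] by blast
  then have "S0 \<noteq> Leaf" using S0 by auto
  then obtain S where S: "S0 = Node Leaf S []" using tilingD(3)[OF m S0] by (cases S0) auto
  have ini: "initial S T" using tilingD(2)[OF m S0] S by simp
  have dom: "\<exists>b\<in>tree_leaves S. \<exists>u. r = 1 # b @ u" if r: "m r = Some R" "r \<noteq> []" for r R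
  proof -
    obtain i v where i: "r = i # v" using r(2) by (cases r) auto
    then consider "i = 0" "v = []" | "i = 1" "v \<in> vertices T"
      using tilingD(1)[OF m r(1)] by auto
    then show ?thesis
    proof cases
      case 1
      then show ?thesis using tilingD(6)[OF m S0, of "[0]"] S r i by auto
    next
      case 2
      from ini 2(2) show ?thesis
      proof (cases rule: initial_cases)
        case 1
        then have "r \<in> tree_leaves S0" using tilingD(7)[OF m S0, of r] S i r 2(1) by auto
        then show ?thesis using 1 S i 2(1) by auto
      next
        case (2 b u)
        then show ?thesis using i \<open>i = 1\<close> by auto
      qed
    qed
  qed
  have "tiling (branch T b) (\<lambda>u. m (1 # b @ u))" if b: "b \<in> tree_leaves S" for b
    unfolding tiling_def
  proof (intro conjI allI impI)
    fix r R assume "m (1 # b @ r) = Some R"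
    note D = tilingD(1-3)[OF m this]
    show "r \<in> vertices (branch T b)" "initial R (branch (branch T b) r)" "right_sided R"
      using D by (simp_all add: vertices_append branch_append)
  next
    show "m (1 # b @ []) \<noteq> None"
      using tilingD(6)[OF m S0, of "1 # b"] S b by simp
  next
    fix v i assume v: "v @ [i] \<in> vertices (branch T b)"
    then have "(1 # b @ v) @ [i] \<in> vertices ?T"
      using initial_leaf_in[OF ini b] by (simp add: vertices_append branch_append)
    then obtain r R w where r: "m r = Some R" "1 # b @ v = r @ w" "w @ [i] \<in> vertices R"
      using tilingD(5)[OF m] by blast
    have "r \<noteq> []"
    proof
      assume "r = []"
      then have "1 # b @ v @ [i] \<in> vertices S0" using r S0 by (metis append.simps append_assoc option.inject)
      then show False using no_vertex_below_leaf[OF b, of "v @ [i]"] S by simp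
    qed
    then obtain b' u where u: "b' \<in> tree_leaves S" "r = 1 # b' @ u" using dom r(1) by blast
    then have "b' = b \<and> u @ w = v" using leaf_prefix_unique[OF u(1) b, of "u @ w" v] r(2) by simp
    then show "\<exists>r R w. m (1 # b @ r) = Some R \<and> v = r @ w \<and> w @ [i] \<in> vertices R"
      using u(2) r by blast
  next
    fix r R c assume "m (1 # b @ r) = Some R" "R \<noteq> Leaf" "c \<in> tree_leaves R"
    from tilingD(6)[OF m this]
    show "m (1 # b @ r @ c) \<noteq> None \<longleftrightarrow> c \<noteq> leftmost_leaf R" by simp
  next
    fix r R w assume "m (1 # b @ r) = Some R" "w \<in> vertices R" "w \<noteq> []" "m (1 # b @ r @ w) \<noteq> None"
    then show "w \<in> tree_leaves R" using tilingD(7)[OF m, of "1 # b @ r" R w] by simp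
  qed
  then show ?thesis using that[OF ini] S0 S dom by blast
qed

text \<open>
  Conversely, all conditions on a tiling can be checked separately for the member at the root
  and within each branch.
\<close>

lemma tiling_right_sidedI:
  assumes S: "initial S T" "m [] = Some (Node Leaf S [])"
    and loc: "\<And>b. b \<in> tree_leaves S \<Longrightarrow> tiling (branch T b) (\<lambda>u. m (1 # b @ u))"
    and dom: "\<And>r. r \<in> dom m \<Longrightarrow> r \<noteq> [] \<Longrightarrow> \<exists>b\<in>tree_leaves S. \<exists>u. r = 1 # b @ u"
  shows "tiling (Node Leaf T []) m"
proof -
  let ?T = "Node Leaf T []"
  have cases: thesis
    if "m r = Some R" "r = [] \<Longrightarrow> R = Node Leaf S [] \<Longrightarrow> thesis"
      "\<And>b u. b \<in> tree_leaves S \<Longrightarrow> r = 1 # b @ u \<Longrightarrow> thesis" for r R thesis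
    using that S dom[of r] by (cases "r = []") auto
  show ?thesis
    unfolding tiling_def
  proof (intro conjI allI impI)
    fix r R assume r: "m r = Some R"
    have "r \<in> vertices ?T \<and> initial R (branch ?T r) \<and> right_sided R"
    proof (rule cases[OF r])
      fix b u assume b: "b \<in> tree_leaves S" "r = 1 # b @ u"
      then show ?thesis
        using tilingD(1-3)[OF loc[OF b(1)], of u R] r initial_leaf_in[OF S(1) b(1)]
        by (simp add: vertices_append branch_append)
    qed (use S in simp)
    then show "r \<in> vertices ?T" "initial R (branch ?T r)" "right_sided R" by blast+
  next
    show "m [] \<noteq> None" using S by simp
  next
    fix v i assume v: "v @ [i] \<in> vertices ?T"
    show "\<exists>r R w. m r = Some R \<and> v = r @ w \<and> w @ [i] \<in> vertices R"
    proof (cases v)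
      case Nil
      then have "[i] \<in> vertices (Node Leaf S [])" using v by auto
      then show ?thesis using S Nil by (metis append_Nil)
    next
      case (Cons j w)
      then have j: "j = 1" and w: "w @ [i] \<in> vertices T" using v by auto
      then have "w \<in> vertices T" by (simp add: vertices_append)
      with S(1) show ?thesis
      proof (cases rule: initial_cases)
        case 1
        then obtain k where "w @ [k] \<in> vertices S" by (auto simp: leaf_vertices_def)
        then have "w @ [i] \<in> vertices S" using S(1) w unfolding initial_def by blast
        then have "v @ [i] \<in> vertices (Node Leaf S [])" using Cons j by simp
        then show ?thesis using S(2) by (metis append_Nil)
      next
        case (2 b u)
        then have "u @ [i] \<in> vertices (branch T b)" using w by (simp add: vertices_append)
        then obtain r R z where "m (1 # b @ r) = Some R" "u = r @ z" "z @ [i] \<in> vertices R"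
          using tilingD(5)[OF loc[OF 2(1)]] by blast
        then show ?thesis using Cons j 2 by (intro exI[of _ "1 # b @ r"]) auto
      qed
    qed
  next
    fix r R c assume r: "m r = Some R" and R: "R \<noteq> Leaf" "c \<in> tree_leaves R"
    show "m (r @ c) \<noteq> None \<longleftrightarrow> c \<noteq> leftmost_leaf R"
    proof (rule cases[OF r])
      assume r0: "r = []" "R = Node Leaf S []"
      then obtain i d where c: "c = i # d" using R(2) by (cases c) auto
      then consider "i = 0" "d = []" | "i = 1" "d \<in> tree_leaves S" using R(2) r0 by auto
      then show ?thesis
      proof cases
        case 1
        then show ?thesis using r0 c dom[of "[0]"] by auto
      next
        case 2
        then show ?thesis using r0 c tilingD(4)[OF loc[OF 2(2)]] by auto
      qed
    next
      fix b u assume b: "b \<in> tree_leaves S" "r = 1 # b @ u"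
      then show ?thesis using tilingD(6)[OF loc[OF b(1)], of u R c] r R by simp
    qed
  next
    fix r R w assume r: "m r = Some R" and w: "w \<in> vertices R" "w \<noteq> []" "m (r @ w) \<noteq> None"
    show "w \<in> tree_leaves R"
    proof (rule cases[OF r])
      assume r0: "r = []" "R = Node Leaf S []"
      then obtain b u where b: "b \<in> tree_leaves S" "w = 1 # b @ u" using w dom[of w] by auto
      then have "u = []" using no_vertex_below_leaf[OF b(1), of u] w(1) r0 by simp
      then show ?thesis using b r0 by simp
    next
      fix b u assume b: "b \<in> tree_leaves S" "r = 1 # b @ u"
      then show ?thesis using tilingD(7)[OF loc[OF b(1)], of u R w] r w by simp
    qed
  qed
qed

text \<open>
  The definite description stands for \<open>F b u\<close>; it is well defined by \<open>leaf_prefix_unique\<close>.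
\<close>

definition glue :: "prt \<Rightarrow> (vertex \<Rightarrow> vertex \<rightharpoonup> prt) \<Rightarrow> (vertex \<rightharpoonup> prt)" where
  "glue S F r = (if r = [] then Some (Node Leaf S [])
     else if \<exists>b\<in>tree_leaves S. \<exists>u. r = 1 # b @ u
     then (THE y. \<exists>b\<in>tree_leaves S. \<exists>u. r = 1 # b @ u \<and> y = F b u)
     else None)"

lemma glue_Nil [simp]: "glue S F [] = Some (Node Leaf S [])"
  by (simp add: glue_def)

lemma glue_below_leaf [simp]:
  assumes "b \<in> tree_leaves S"
  shows "glue S F (1 # b @ u) = F b u"
proof -
  have "(THE y. \<exists>b'\<in>tree_leaves S. \<exists>u'. 1 # b @ u = 1 # b' @ u' \<and> y = F b' u') = F b u"
  proof (rule the_equality)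
    fix y assume "\<exists>b'\<in>tree_leaves S. \<exists>u'. 1 # b @ u = 1 # b' @ u' \<and> y = F b' u'"
    then obtain b' u' where "b' \<in> tree_leaves S" "b @ u = b' @ u'" "y = F b' u'" by blast
    then show "y = F b u" using leaf_prefix_unique[OF assms] by metis
  qed (use assms in blast)
  then show ?thesis using assms by (auto simp: glue_def)
qed

lemma dom_glueD: "r \<in> dom (glue S F) \<Longrightarrow> r \<noteq> [] \<Longrightarrow> \<exists>b\<in>tree_leaves S. \<exists>u. r = 1 # b @ u"
  by (auto simp: glue_def split: if_splits)

lemma dom_glue:
  "dom (glue S F) = insert [] (\<Union>b\<in>tree_leaves S. (\<lambda>u. 1 # b @ u) ` dom (F b))"
proof (intro equalityI subsetI)
  fix r assume r: "r \<in> dom (glue S F)"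
  show "r \<in> insert [] (\<Union>b\<in>tree_leaves S. (\<lambda>u. 1 # b @ u) ` dom (F b))"
  proof (cases "r = []")
    case False
    then obtain b u where "b \<in> tree_leaves S" "r = 1 # b @ u" using dom_glueD[OF r] by blast
    moreover from this have "u \<in> dom (F b)" using r by (auto simp del: One_nat_def)
    ultimately show ?thesis by blast
  qed simp
qed (auto simp del: One_nat_def)

text \<open>
  The members below different leaves of \<open>S\<close> have different roots, so the product over all members
  splits; the factor \<open>f (Some S)\<close> belongs to the member \<open>x\<cdot>S\<close>.
\<close>

lemma tiling_coeff_glue:
  assumes "\<And>b. b \<in> tree_leaves S \<Longrightarrow> finite (dom (F b))"
  shows "tiling_coeff f (glue S F) = f (Some S) * (\<Prod>b\<in>tree_leaves S. tiling_coeff f (F b))"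
proof -
  let ?A = "\<lambda>b. (\<lambda>u. 1 # b @ u) ` dom (F b)"
  let ?p = "\<lambda>r. f (right_part (the (glue S F r)))"
  have "tiling_coeff f (glue S F) = ?p [] * prod ?p (\<Union>b\<in>tree_leaves S. ?A b)"
    unfolding tiling_coeff_def dom_glue using assms by (subst prod.insert) (auto simp: finite_tree_leaves)
  also have "prod ?p (\<Union>b\<in>tree_leaves S. ?A b) = (\<Prod>b\<in>tree_leaves S. prod ?p (?A b))"
  proof (intro prod.UNION_disjoint ballI impI)
    show "?A b \<inter> ?A b' = {}" if "b \<in> tree_leaves S" "b' \<in> tree_leaves S" "b \<noteq> b'" for b b'
      using leaf_prefix_unique[OF that(1,2)] that(3) by blast
  qed (use assms in \<open>simp_all add: finite_tree_leaves\<close>)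
  also have "\<dots> = (\<Prod>b\<in>tree_leaves S. tiling_coeff f (F b))"
  proof (rule prod.cong[OF refl])
    fix b assume "b \<in> tree_leaves S"
    then show "prod ?p (?A b) = tiling_coeff f (F b)"
      unfolding tiling_coeff_def
      by (subst prod.reindex) (auto simp: inj_on_def simp del: One_nat_def)
  qed
  finally show ?thesis by simp
qed

lemma tilings_right_sided:
  "bij_betw (\<lambda>(S, F). glue S F)
     (SIGMA S:{S. initial S T}. \<Pi>\<^sub>E b\<in>tree_leaves S. {m. tiling (branch T b) m})
     {m. tiling (Node Leaf T []) m}"
proof (rule bij_betw_imageI)
  show "inj_on (\<lambda>(S, F). glue S F)
     (SIGMA S:{S. initial S T}. \<Pi>\<^sub>E b\<in>tree_leaves S. {m. tiling (branch T b) m})"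
  proof (rule inj_onI, clarify)
    fix S F S' F'
    assume F: "F \<in> (\<Pi>\<^sub>E b\<in>tree_leaves S. {m. tiling (branch T b) m})"
      "F' \<in> (\<Pi>\<^sub>E b\<in>tree_leaves S'. {m. tiling (branch T b) m})"
      and eq: "glue S F = glue S' F'"
    have S: "S = S'" using fun_cong[OF eq, of "[]"] by simp
    have "F b = F' b" if "b \<in> tree_leaves S" for b
    proof
      fix u
      show "F b u = F' b u"
        using fun_cong[OF eq, of "1 # b @ u"]
        unfolding S[symmetric] glue_below_leaf[OF that] .
    qed
    then have "F = F'" using F S by (intro PiE_ext) auto
    with S show "S = S' \<and> F = F'" by blast
  qed
  show "(\<lambda>(S, F). glue S F) `
      (SIGMA S:{S. initial S T}. \<Pi>\<^sub>E b\<in>tree_leaves S. {m. tiling (branch T b) m}) =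
      {m. tiling (Node Leaf T []) m}" (is "_ ` ?D = _")
  proof (intro equalityI subsetI)
    fix m assume "m \<in> (\<lambda>(S, F). glue S F) ` ?D"
    then obtain S F where m: "m = glue S F" and S: "initial S T"
      and F: "F \<in> (\<Pi>\<^sub>E b\<in>tree_leaves S. {m. tiling (branch T b) m})" by auto
    have "tiling (Node Leaf T []) m"
    proof (rule tiling_right_sidedI[OF S])
      show "m [] = Some (Node Leaf S [])" using m by simp
      show "tiling (branch T b) (\<lambda>u. m (1 # b @ u))" if "b \<in> tree_leaves S" for b
        using F that m by (auto simp del: One_nat_def)
    qed (use m dom_glueD in blast)
    then show "m \<in> {m. tiling (Node Leaf T []) m}" by simp
  next
    fix m assume "m \<in> {m. tiling (Node Leaf T []) m}"
    then obtain S where S: "initial S T" "m [] = Some (Node Leaf S [])"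
      and loc: "\<And>b. b \<in> tree_leaves S \<Longrightarrow> tiling (branch T b) (\<lambda>u. m (1 # b @ u))"
      and dom: "\<And>r. r \<in> dom m \<Longrightarrow> r \<noteq> [] \<Longrightarrow> \<exists>b\<in>tree_leaves S. \<exists>u. r = 1 # b @ u"
      using tiling_right_sidedD by blast
    define F where "F = (\<lambda>b\<in>tree_leaves S. \<lambda>u. m (1 # b @ u))"
    have "m r = glue S F r" for r
    proof (cases "r = [] \<or> (\<exists>b\<in>tree_leaves S. \<exists>u. r = 1 # b @ u)")
      case True
      then show ?thesis using S by (auto simp: F_def simp del: One_nat_def)
    next
      case False
      then have "m r = None" "glue S F r = None" using dom dom_glueD by blast+
      then show ?thesis by simp
    qed
    moreover have "(S, F) \<in> ?D" using S loc by (auto simp: F_def)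
    ultimately show "m \<in> (\<lambda>(S, F). glue S F) ` ?D" by (auto intro!: image_eqI[of _ _ "(S, F)"])
  qed
qed

lemma sum_tilings_right_sided:
  fixes f :: "'k::field tree_series"
  shows "(\<Sum>m | tiling (Node Leaf T []) m. tiling_coeff f m) =
    (\<Sum>S | initial S T. f (Some S) *
      (\<Prod>b\<in>tree_leaves S. \<Sum>m | tiling (branch T b) m. tiling_coeff f m))"
proof -
  let ?P = "\<lambda>S. \<Pi>\<^sub>E b\<in>tree_leaves S. {m. tiling (branch T b) m}"
  have "(\<Sum>m | tiling (Node Leaf T []) m. tiling_coeff f m) =
      (\<Sum>(S, F)\<in>(SIGMA S:{S. initial S T}. ?P S). tiling_coeff f (glue S F))"
    using sum.reindex_bij_betw[OF tilings_right_sided, of "tiling_coeff f" T]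
    by (simp add: case_prod_unfold)
  also have "\<dots> = (\<Sum>S | initial S T. \<Sum>F\<in>?P S. tiling_coeff f (glue S F))"
    by (subst sum.Sigma) (auto simp: finite_initial finite_tree_leaves finite_tilings intro!: finite_PiE)
  also have "\<dots> = (\<Sum>S | initial S T. \<Sum>F\<in>?P S.
      f (Some S) * (\<Prod>b\<in>tree_leaves S. tiling_coeff f (F b)))"
    by (intro sum.cong refl tiling_coeff_glue) (auto dest!: PiE_mem intro: finite_dom_tiling)
  also have "\<dots> = (\<Sum>S | initial S T. f (Some S) *
      (\<Prod>b\<in>tree_leaves S. \<Sum>m | tiling (branch T b) m. tiling_coeff f m))"
    by (simp add: sum_distrib_left[symmetric] prod_sum_PiE finite_tree_leaves finite_tilings)
  finally show ?thesis .
qed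


section \<open>The inversion formula\<close>

text \<open>
  The recursion leads from \<open>T\<close> to branches that need not be right-sided or have more than one leaf,
  so the induction runs over all trees. If \<open>T\<close> is not right-sided, both sides vanish.
\<close>

lemma coeff_eq_sum_tilings:
  fixes f g :: "'k::field tree_series"
  assumes "g = series_mult series_x (series_subst f g)"
  shows "g (Some T) = (\<Sum>m | tiling T m. tiling_coeff f m)"
proof (induction "deg T" arbitrary: T rule: less_induct)
  case less
  have g: "g (Some T) = (if right_sided T then series_subst f g (right_part T) else 0)"
    using fun_cong[OF assms, of "Some T"] by (simp add: series_mult_x)
  show ?case
  proof (cases "right_sided T")
    case False
    then have "{m. tiling T m} = {}" using tiling_right_sided by blast
    then show ?thesis using g False by (simp only: sum.empty if_False)
  next
    case True
    then consider "T = Leaf" | T' where "T = Node Leaf T' []" by (cases T) auto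
    then show ?thesis
    proof cases
      case 1
      then show ?thesis using g by (simp add: tilings_Leaf tiling_coeff_def series_subst_None)
    next
      case 2
      have "g (Some (branch T' b)) = (\<Sum>m | tiling (branch T' b) m. tiling_coeff f m)"
        if "initial S T'" "b \<in> tree_leaves S" for S b
      proof (rule less)
        show "deg (branch T' b) < deg T"
          using deg_branch_le[OF initial_leaf_in[OF that]] 2 by simp
      qed
      then have "series_subst f g (Some T') = (\<Sum>m | tiling T m. tiling_coeff f m)"
        unfolding 2 series_subst_Some sum_tilings_right_sided by (intro sum.cong) auto
      then show ?thesis using g 2 by simp
    qed
  qed
qed

theorem theorem4p4:
  fixes f g :: "'k::field tree_series"
  assumes "series_ord g \<ge> 1"
    and "g = series_mult series_x (series_subst f g)"
  shows "g (Some Leaf) = f None \<and>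
    (\<forall>T. right_sided T \<and> deg T > 1 \<longrightarrow>
      g (Some T) = (\<Sum>Q\<in>right_sided_decompositions T. decomposition_coeff f Q))"
proof
  show "g (Some Leaf) = f None"
    using fun_cong[OF assms(2), of "Some Leaf"] by (simp add: series_mult_x series_subst_None)
qed (use coeff_eq_sum_tilings[OF assms(2)] in \<open>simp add: sum_decompositions\<close>)

end
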